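(* Let $M$ be a Cowen-Douglas atom on a Hilbert space $\mathcal{H}_K$ with reproducing kernel $K$, and let $M_z$ be the operator of multiplication by $z$ on the Bergman space of $\mathbb{D}$. Suppose there exists $C>0$ such that $(1-|\omega|^2)^2K(\overline{\omega},\overline{\omega})\ge C$ for all $\omega\in\mathbb{D}$. If $I_1,I_2\in Lat(M_z)$ are such that for $i=1,2$: (1) $(M_{I_i})^*\in B_1(\mathbb{D})$ and $(M_{I_i})^*$ is $M$-contractive; (2) $\inf\Big\{\dfrac{h_{(M_{I_i})^*}(\omega)}{K(\overline{\omega},\overline{\omega})}:\ \omega\in\mathbb{D}\Big\}>0$, where $h_{(M_{I_i})^*}(\omega)=\|P_{I_i}k_{\overline{\omega}}\|^2$ and $k_{\lambda}(z)=(1-z\overline{\lambda})^{-2}$ is the Bergman kernel function at $\lambda$, then $M_{I_1}$ is similar to $M_{I_2}$.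
   Context: The Bergman space is the Hilbert space of analytic functions on the unit disk $\mathbb{D}$ with reproducing kernel $(1-z\overline{w})^{-2}$. $Lat(M_z)$ is the set of closed $M_z$-invariant subspaces; $M_I:=M_z|_I$ for $I\in Lat(M_z)$; $P_I$ is the orthogonal projection onto $I$. Operators $A\in\mathcal{L}(\mathcal{H})$, $B\in\mathcal{L}(\mathcal{K})$ are similar if $XA=BX$ for some bounded invertible $X:\mathcal{H}\to\mathcal{K}$. For a bounded connected open set $\Omega\subset\mathbb{C}$, $B_1(\Omega)$ is the set of bounded operators $T$ on a complex separable Hilbert space $\mathcal{H}$ such that for all $\omega\in\Omega$, $T-\omega$ is surjective and $\dim\ker(T-\omega)=1$, and the closed linear span of $\bigcup_{\omega\in\Omega}\ker(T-\omega)$ is $\mathcal{H}$. Cowen-Douglas atom: let $\mathcal{H}_K$ be a Hilbert space of analytic functions on $\mathbb{D}$ with reproducing kernel $K:\mathbb{D}\times\mathbb{D}\to\mathbb{C}$ (holomorphic in the first and anti-holomorphic in the second variable) on which multiplication by $z$, here denoted $N_z$, is bounded, and suppose $N_z^*\in B_1(\mathbb{D})$. Then $M:=N_z^*$ is called a Cowen-Douglas atom if (1) the polynomials $\mathbb{C}[z]$ are dense in $\mathcal{H}_K$; (2) there is a sequence of polynomials $p_l(z,\overline{\omega})\in\mathbb{C}[z,\overline{\omega}]$ with $p_l(z,\overline{\omega})\to\frac{1}{K(z,\omega)}$ as $l\to\infty$ for all $z,\omega\in\mathbb{D}$; (3) $\sup_l\|p_l(N_z,N_z^* )\|<\infty$;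 (4) the commutant of $N_z$ is $\{M_\varphi:\varphi\in H^\infty(\mathbb{D})\}$. The sequence $\{p_l\}$ is fixed together with $M$. For $p(z,\overline{\omega})=\sum a_{ij}z^i\overline{\omega}^j$ and an operator $S$, $p(S^*,S)=\sum a_{ij}S^{*i}S^j$ (and $p(N_z,N_z^* )=\sum a_{ij}N_z^iN_z^{*j}$). An operator $S$ is $M$-contractive if $\sup_l\|p_l(S^*,S)\|<\infty$ and $p_l(S^*,S)$ converges in the weak operator topology to a positive (i.e. nonnegative) operator. *)

theory Defs
  imports
    "HOL-Analysis.Analysis"
    "HOL-Library.Function_Algebras"
    "HOL-Computational_Algebra.Polynomial"
begin

section \<open>Complex vector spaces\<close>

class complex_vector = ab_group_add +
  fixes scaleC :: "complex \<Rightarrow> 'a \<Rightarrow> 'a"  (infixr \<open>*\<^sub>C\<close> 75)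
  assumes scaleC_add_right: "a *\<^sub>C (x + y) = a *\<^sub>C x + a *\<^sub>C y"
    and scaleC_add_left: "(a + b) *\<^sub>C x = a *\<^sub>C x + b *\<^sub>C x"
    and scaleC_scaleC: "a *\<^sub>C b *\<^sub>C x = (a * b) *\<^sub>C x"
    and scaleC_one: "1 *\<^sub>C x = x"

global_interpretation cvec: vector_space "scaleC :: complex \<Rightarrow> 'a \<Rightarrow> 'a::complex_vector"
  by unfold_locales (fact scaleC_add_right scaleC_add_left scaleC_scaleC scaleC_one)+

instantiation complex :: complex_vector
begin

definition scaleC_complex :: "complex \<Rightarrow> complex \<Rightarrow> complex"
  where "scaleC_complex a x = a * x"

instance
  by standard (simp_all add: scaleC_complex_def algebra_simps)

end

instantiation "fun" :: (type, complex_vector) complex_vector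
begin

definition scaleC_fun :: "complex \<Rightarrow> ('a \<Rightarrow> 'b) \<Rightarrow> 'a \<Rightarrow> 'b"
  where "scaleC_fun a f = (\<lambda>x. a *\<^sub>C f x)"

instance
  by standard
    (simp_all add: scaleC_fun_def plus_fun_def scaleC_add_right scaleC_add_left scaleC_scaleC
      scaleC_one)

end


section \<open>Complex Hilbert spaces\<close>

text \<open>
  A Hilbert space is a linear subspace of an ambient complex vector space together with an inner
  product, which is linear in its first argument.  Only the values of the inner product and of
  operators on the carrier are relevant, so a closed subspace \<open>I\<close> of \<open>H\<close> is
  \<open>H\<lparr>carrier := I\<rparr>\<close>, and the restriction of an operator to it is the same function.
\<close>

record 'a hilbert =
  carrier :: "'a set"
  ip :: "'a \<Rightarrow> 'a \<Rightarrow> complex"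

definition hnorm :: "'a hilbert \<Rightarrow> 'a \<Rightarrow> real"
  where "hnorm H x = sqrt (Re (ip H x x))"

locale complex_hilbert_space =
  fixes H :: "'a::complex_vector hilbert"
  assumes subspace_carrier: "cvec.subspace (carrier H)"
    and ip_add_left: "\<lbrakk>x \<in> carrier H; y \<in> carrier H; z \<in> carrier H\<rbrakk>
          \<Longrightarrow> ip H (x + y) z = ip H x z + ip H y z"
    and ip_scaleC_left: "\<lbrakk>x \<in> carrier H; y \<in> carrier H\<rbrakk> \<Longrightarrow> ip H (a *\<^sub>C x) y = a * ip H x y"
    and ip_commute: "\<lbrakk>x \<in> carrier H; y \<in> carrier H\<rbrakk> \<Longrightarrow> ip H x y = cnj (ip H y x)"
    and ip_pos: "\<lbrakk>x \<in> carrier H; x \<noteq> 0\<rbrakk> \<Longrightarrow> Re (ip H x x) > 0"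
    and complete: "\<lbrakk>\<And>n. s n \<in> carrier H;
            \<And>e. e > 0 \<Longrightarrow> \<exists>N. \<forall>m\<ge>N. \<forall>n\<ge>N. hnorm H (s m - s n) < e\<rbrakk>
          \<Longrightarrow> \<exists>x\<in>carrier H. (\<lambda>n. hnorm H (s n - x)) \<longlonglongrightarrow> 0"

definition hclosure :: "'a::complex_vector hilbert \<Rightarrow> 'a set \<Rightarrow> 'a set"
  where "hclosure H S = {x \<in> carrier H. \<forall>e>0. \<exists>y\<in>S. hnorm H (x - y) < e}"

definition separable_hilbert :: "'a::complex_vector hilbert \<Rightarrow> bool"
  where "separable_hilbert H \<longleftrightarrow>
    (\<exists>D \<subseteq> carrier H. countable D \<and> hclosure H D = carrier H)"

definition bounded_op ::
    "'a::complex_vector hilbert \<Rightarrow> 'b::complex_vector hilbert \<Rightarrow> ('a \<Rightarrow> 'b) \<Rightarrow> bool"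
  where "bounded_op H K A \<longleftrightarrow>
    A \<in> carrier H \<rightarrow> carrier K \<and>
    (\<forall>x\<in>carrier H. \<forall>y\<in>carrier H. A (x + y) = A x + A y) \<and>
    (\<forall>a. \<forall>x\<in>carrier H. A (a *\<^sub>C x) = a *\<^sub>C A x) \<and>
    (\<exists>B. \<forall>x\<in>carrier H. hnorm K (A x) \<le> B * hnorm H x)"

definition adj :: "'a hilbert \<Rightarrow> ('a \<Rightarrow> 'a) \<Rightarrow> 'a \<Rightarrow> 'a"
  where "adj H A x = (THE y. y \<in> carrier H \<and> (\<forall>u\<in>carrier H. ip H (A u) x = ip H u y))"

definition orth_proj :: "'a::complex_vector hilbert \<Rightarrow> 'a set \<Rightarrow> 'a \<Rightarrow> 'a"
  where "orth_proj H I x = (THE y. y \<in> I \<and> (\<forall>u\<in>I. ip H (x - y) u = 0))"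

definition Lat :: "'a::complex_vector hilbert \<Rightarrow> ('a \<Rightarrow> 'a) \<Rightarrow> 'a set set"
  where "Lat H A =
    {I. I \<subseteq> carrier H \<and> cvec.subspace I \<and> hclosure H I = I \<and> A ` I \<subseteq> I}"

definition similar_ops ::
    "'a::complex_vector hilbert \<Rightarrow> ('a \<Rightarrow> 'a) \<Rightarrow> 'b::complex_vector hilbert \<Rightarrow> ('b \<Rightarrow> 'b) \<Rightarrow> bool"
  where "similar_ops H A K B \<longleftrightarrow>
    (\<exists>X Y. bounded_op H K X \<and> bounded_op K H Y \<and>
      (\<forall>x\<in>carrier H. Y (X x) = x) \<and> (\<forall>y\<in>carrier K. X (Y y) = y) \<and>
      (\<forall>x\<in>carrier H. X (A x) = B (X x)))"

text \<open>Operators are identified when they agree on the carrier, hence the \<^const>\<open>extensional\<close>.\<close>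

definition commutant :: "'a::complex_vector hilbert \<Rightarrow> ('a \<Rightarrow> 'a) \<Rightarrow> ('a \<Rightarrow> 'a) set"
  where "commutant H A =
    {B \<in> extensional (carrier H). bounded_op H H B \<and> (\<forall>x\<in>carrier H. B (A x) = A (B x))}"

definition uniformly_bounded_ops ::
    "'a::complex_vector hilbert \<Rightarrow> (nat \<Rightarrow> 'a \<Rightarrow> 'a) \<Rightarrow> bool"
  where "uniformly_bounded_ops H A \<longleftrightarrow>
    (\<exists>B. \<forall>l. \<forall>x\<in>carrier H. hnorm H (A l x) \<le> B * hnorm H x)"

definition positive_op :: "'a::complex_vector hilbert \<Rightarrow> ('a \<Rightarrow> 'a) \<Rightarrow> bool"
  where "positive_op H P \<longleftrightarrow>
    bounded_op H H P \<and> (\<forall>x\<in>carrier H. ip H (P x) x \<in> \<real>\<^sub>\<ge>\<^sub>0)"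

definition wot_tendsto ::
    "'a::complex_vector hilbert \<Rightarrow> (nat \<Rightarrow> 'a \<Rightarrow> 'a) \<Rightarrow> ('a \<Rightarrow> 'a) \<Rightarrow> bool"
  where "wot_tendsto H A P \<longleftrightarrow>
    (\<forall>x\<in>carrier H. \<forall>y\<in>carrier H. (\<lambda>l. ip H (A l x) y) \<longlonglongrightarrow> ip H (P x) y)"


section \<open>The Cowen-Douglas class\<close>

definition eigenspace ::
    "'a::complex_vector hilbert \<Rightarrow> ('a \<Rightarrow> 'a) \<Rightarrow> complex \<Rightarrow> 'a set"
  where "eigenspace H T \<omega> = {x \<in> carrier H. T x - \<omega> *\<^sub>C x = 0}"

definition B1 :: "'a::complex_vector hilbert \<Rightarrow> complex set \<Rightarrow> ('a \<Rightarrow> 'a) \<Rightarrow> bool"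
  where "B1 H \<Omega> T \<longleftrightarrow>
    open \<Omega> \<and> connected \<Omega> \<and> bounded \<Omega> \<and>
    complex_hilbert_space H \<and> separable_hilbert H \<and> bounded_op H H T \<and>
    (\<forall>\<omega>\<in>\<Omega>. (\<lambda>x. T x - \<omega> *\<^sub>C x) ` carrier H = carrier H) \<and>
    (\<forall>\<omega>\<in>\<Omega>. cvec.dim (eigenspace H T \<omega>) = 1) \<and>
    hclosure H (cvec.span (\<Union>\<omega>\<in>\<Omega>. eigenspace H T \<omega>)) = carrier H"


section \<open>Polynomials in two variables\<close>

text \<open>
  A polynomial \<open>p(z, w) = \<Sum> a\<^sub>i\<^sub>j z\<^sup>i w\<^sup>j\<close> is a \<^typ>\<open>complex poly poly\<close> in \<open>z\<close> whose coefficients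
  are polynomials in \<open>w\<close>, so \<open>a\<^sub>i\<^sub>j = coeff (coeff p i) j\<close>.  In the operator version all powers of
  the first operator stand to the left of those of the second.
\<close>

definition poly2 :: "complex poly poly \<Rightarrow> complex \<Rightarrow> complex \<Rightarrow> complex"
  where "poly2 p z w =
    (\<Sum>i\<le>degree p. \<Sum>j\<le>degree (coeff p i). coeff (coeff p i) j * z ^ i * w ^ j)"

definition poly2_op ::
    "complex poly poly \<Rightarrow> ('a \<Rightarrow> 'a) \<Rightarrow> ('a \<Rightarrow> 'a) \<Rightarrow> 'a \<Rightarrow> 'a::complex_vector"
  where "poly2_op p A B x =
    (\<Sum>i\<le>degree p. \<Sum>j\<le>degree (coeff p i).
      coeff (coeff p i) j *\<^sub>C (A ^^ i) ((B ^^ j) x))"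


section \<open>Hilbert spaces of analytic functions on the unit disk\<close>

abbreviation \<D> :: "complex set"
  where "\<D> \<equiv> ball 0 1"

text \<open>
  Functions on the disk are represented by functions on \<open>\<complex>\<close> that vanish off the disk, so that
  equality in the function space is equality on the disk.
\<close>

definition on_disk :: "(complex \<Rightarrow> complex) \<Rightarrow> complex \<Rightarrow> complex"
  where "on_disk f z = (if z \<in> \<D> then f z else 0)"

locale analytic_rkhs = complex_hilbert_space H
  for H :: "(complex \<Rightarrow> complex) hilbert" +
  fixes K :: "complex \<Rightarrow> complex \<Rightarrow> complex"
  assumes holomorphic: "f \<in> carrier H \<Longrightarrow> f holomorphic_on \<D>"
    and vanishes: "\<lbrakk>f \<in> carrier H; z \<notin> \<D>\<rbrakk> \<Longrightarrow> f z = 0"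
    and kernel_holomorphic: "w \<in> \<D> \<Longrightarrow> (\<lambda>z. K z w) holomorphic_on \<D>"
    and kernel_antiholomorphic: "z \<in> \<D> \<Longrightarrow> (\<lambda>w. cnj (K z w)) holomorphic_on \<D>"
    and kernel_mem: "w \<in> \<D> \<Longrightarrow> on_disk (\<lambda>z. K z w) \<in> carrier H"
    and reproducing: "\<lbrakk>f \<in> carrier H; w \<in> \<D>\<rbrakk> \<Longrightarrow> ip H f (on_disk (\<lambda>z. K z w)) = f w"

definition mult_op :: "(complex \<Rightarrow> complex) \<Rightarrow> (complex \<Rightarrow> complex) \<Rightarrow> complex \<Rightarrow> complex"
  where "mult_op \<phi> f = (\<lambda>z. \<phi> z * f z)"

abbreviation Mz :: "(complex \<Rightarrow> complex) \<Rightarrow> complex \<Rightarrow> complex"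
  where "Mz \<equiv> mult_op (\<lambda>z. z)"

definition Hinf :: "(complex \<Rightarrow> complex) set"
  where "Hinf = {\<phi>. \<phi> holomorphic_on \<D> \<and> bounded (\<phi> ` \<D>)}"

definition bergman_kernel :: "complex \<Rightarrow> complex \<Rightarrow> complex"
  where "bergman_kernel z w = 1 / (1 - z * cnj w)\<^sup>2"

text \<open>
  The function \<open>h\<close> of the adjoint of \<open>M\<^sub>z\<close> restricted to an invariant subspace \<open>I\<close> of the Bergman
  space \<open>A2\<close>.
\<close>

definition bergman_h ::
    "(complex \<Rightarrow> complex) hilbert \<Rightarrow> (complex \<Rightarrow> complex) set \<Rightarrow> complex \<Rightarrow> real"
  where "bergman_h A2 I \<omega> =
    (hnorm A2 (orth_proj A2 I (on_disk (\<lambda>z. bergman_kernel z (cnj \<omega>)))))\<^sup>2"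


section \<open>Cowen-Douglas atoms and contractivity\<close>

text \<open>
  \<open>cowen_douglas_atom H K p\<close> states that \<open>M = M\<^sub>z\<^sup>*\<close> on the space \<open>H\<close> with kernel \<open>K\<close> is a
  Cowen-Douglas atom with associated polynomials \<open>p\<close>.  That \<open>1 / K\<close> is defined on the whole
  bidisk is made explicit, since division by zero is total here.
\<close>

definition cowen_douglas_atom ::
    "(complex \<Rightarrow> complex) hilbert \<Rightarrow> (complex \<Rightarrow> complex \<Rightarrow> complex) \<Rightarrow>
      (nat \<Rightarrow> complex poly poly) \<Rightarrow> bool"
  where "cowen_douglas_atom H K p \<longleftrightarrow>
    analytic_rkhs H K \<and> bounded_op H H Mz \<and> B1 H \<D> (adj H Mz) \<and>
    range (\<lambda>q. on_disk (poly q)) \<subseteq> carrier H \<and>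
    hclosure H (range (\<lambda>q. on_disk (poly q))) = carrier H \<and>
    (\<forall>z\<in>\<D>. \<forall>\<omega>\<in>\<D>. K z \<omega> \<noteq> 0 \<and> (\<lambda>l. poly2 (p l) z (cnj \<omega>)) \<longlonglongrightarrow> 1 / K z \<omega>) \<and>
    uniformly_bounded_ops H (\<lambda>l. poly2_op (p l) Mz (adj H Mz)) \<and>
    commutant H Mz = {restrict (mult_op \<phi>) (carrier H) | \<phi>. \<phi> \<in> Hinf}"

text \<open>\<open>M\<close>-contractivity depends on the atom \<open>M\<close> only through its polynomials \<open>p\<close>.\<close>

definition atom_contractive ::
    "(nat \<Rightarrow> complex poly poly) \<Rightarrow> 'a::complex_vector hilbert \<Rightarrow> ('a \<Rightarrow> 'a) \<Rightarrow> bool"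
  where "atom_contractive p H S \<longleftrightarrow>
    uniformly_bounded_ops H (\<lambda>l. poly2_op (p l) (adj H S) S) \<and>
    (\<exists>P. positive_op H P \<and> wot_tendsto H (\<lambda>l. poly2_op (p l) (adj H S) S) P)"

end

theory Submission
  imports Defs "HOL-Complex_Analysis.Cauchy_Integral_Formula"
begin

text \<open>
  The hypotheses force \<open>I\<^sub>1\<close> and \<open>I\<^sub>2\<close> to be the whole Bergman space, so the identity is a similarity.
  By (2) and the lower bound on \<open>K\<close>, the reproducing kernel of \<open>I = I\<^sub>i\<close> on the diagonal is at least a
  constant multiple of \<open>(1 - \<bar>w\<bar>\<^sup>2)\<^sup>-\<^sup>2\<close>.  By the Cowen-Douglas condition at \<open>0\<close>, the orthogonal complement
  of \<open>z I\<close> in \<open>I\<close> is spanned by a unit vector \<open>\<phi>\<close>.  Shimorin's inequality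
  \<open>\<parallel>z x + y\<parallel>\<^sup>2 \<le> 2 (\<parallel>x\<parallel>\<^sup>2 + \<parallel>z y\<parallel>\<^sup>2)\<close> bounds the kernel of \<open>I\<close> at \<open>w\<close> from above by
  \<open>\<bar>\<phi>(w)\<bar>\<^sup>2 (1 - \<bar>w\<bar>\<^sup>2)\<^sup>-\<^sup>2\<close>.  Hence \<open>\<bar>\<phi>\<bar>\<close> is bounded below on the disk, every Bergman kernel function is a
  bounded holomorphic multiple of \<open>\<phi>\<close>, and such multiples lie in \<open>I\<close> as weak limits of polynomial multiples.
\<close>

section \<open>Projections in Hilbert spaces\<close>

context complex_hilbert_space
begin

section \<open>Algebra of the carrier and the inner product\<close>

lemma zero_mem [simp]: "0 \<in> carrier H"
  using cvec.subspace_0[OF subspace_carrier] .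

lemma add_mem [simp]: "\<lbrakk>x \<in> carrier H; y \<in> carrier H\<rbrakk> \<Longrightarrow> x + y \<in> carrier H"
  using cvec.subspace_add[OF subspace_carrier] .

lemma scale_mem [simp]: "x \<in> carrier H \<Longrightarrow> a *\<^sub>C x \<in> carrier H"
  using cvec.subspace_scale[OF subspace_carrier] .

lemma diff_mem [simp]: "\<lbrakk>x \<in> carrier H; y \<in> carrier H\<rbrakk> \<Longrightarrow> x - y \<in> carrier H"
  using cvec.subspace_diff[OF subspace_carrier] .

lemma sum_mem: "(\<And>i. i \<in> A \<Longrightarrow> f i \<in> carrier H) \<Longrightarrow> sum f A \<in> carrier H"
  using cvec.subspace_sum[OF subspace_carrier] .

lemma ip_diff_left:
  assumes "x \<in> carrier H" "y \<in> carrier H" "z \<in> carrier H"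
  shows "ip H (x - y) z = ip H x z - ip H y z"
  using ip_add_left[of "x - y" y z] assms by simp

lemma ip_add_right:
  assumes "x \<in> carrier H" "y \<in> carrier H" "z \<in> carrier H"
  shows "ip H z (x + y) = ip H z x + ip H z y"
  using assms ip_commute[of z "x + y"] ip_commute[of z x] ip_commute[of z y]
  by (simp add: ip_add_left)

lemma ip_diff_right:
  assumes "x \<in> carrier H" "y \<in> carrier H" "z \<in> carrier H"
  shows "ip H z (x - y) = ip H z x - ip H z y"
  using ip_add_right[of "x - y" y z] assms by simp

lemma ip_scaleC_right:
  assumes "x \<in> carrier H" "y \<in> carrier H"
  shows "ip H x (a *\<^sub>C y) = cnj a * ip H x y"
  using assms ip_commute[of x "a *\<^sub>C y"] ip_commute[of x y] by (simp add: ip_scaleC_left)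

lemma ip_zero_left [simp]: "x \<in> carrier H \<Longrightarrow> ip H 0 x = 0"
  using ip_diff_left[of 0 0 x] by simp

lemma ip_zero_right [simp]: "x \<in> carrier H \<Longrightarrow> ip H x 0 = 0"
  using ip_diff_right[of 0 0 x] by simp

lemma ip_sum_left:
  assumes "\<And>i. i \<in> A \<Longrightarrow> f i \<in> carrier H" "x \<in> carrier H"
  shows "ip H (sum f A) x = (\<Sum>i\<in>A. ip H (f i) x)"
  using assms(1)
proof (induction A rule: infinite_finite_induct)
  case (insert i A)
  then show ?case using assms(2) by (simp add: ip_add_left sum_mem)
qed (use assms(2) in auto)

lemma ip_sum_right:
  assumes "\<And>i. i \<in> A \<Longrightarrow> f i \<in> carrier H" "x \<in> carrier H"
  shows "ip H x (sum f A) = (\<Sum>i\<in>A. ip H x (f i))"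
  using assms(1)
proof (induction A rule: infinite_finite_induct)
  case (insert i A)
  then show ?case using assms(2) by (simp add: ip_add_right sum_mem)
qed (use assms(2) in auto)

lemma ip_lincomb_self:
  assumes "\<And>i. i \<in> A \<Longrightarrow> e i \<in> carrier H"
  shows "ip H (\<Sum>i\<in>A. c i *\<^sub>C e i) (\<Sum>i\<in>A. c i *\<^sub>C e i)
    = (\<Sum>i\<in>A. \<Sum>j\<in>A. c i * cnj (c j) * ip H (e i) (e j))"
proof -
  let ?f = "\<Sum>i\<in>A. c i *\<^sub>C e i"
  have "ip H ?f ?f = (\<Sum>i\<in>A. c i * ip H (e i) ?f)"
    using assms by (subst ip_sum_left) (auto simp: sum_mem ip_scaleC_left)
  also have "\<dots> = (\<Sum>i\<in>A. c i * (\<Sum>j\<in>A. cnj (c j) * ip H (e i) (e j)))"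
    using assms by (simp add: ip_sum_right ip_scaleC_right)
  finally show ?thesis by (simp add: sum_distrib_left mult.assoc)
qed

section \<open>Norm identities and the Cauchy-Schwarz inequality\<close>

lemma Re_ip_self_nonneg: "x \<in> carrier H \<Longrightarrow> 0 \<le> Re (ip H x x)"
  using ip_pos[of x] by (cases "x = 0") auto

lemma hnorm_sq: "x \<in> carrier H \<Longrightarrow> (hnorm H x)\<^sup>2 = Re (ip H x x)"
  by (simp add: hnorm_def Re_ip_self_nonneg)

lemma hnorm_nonneg [simp]: "x \<in> carrier H \<Longrightarrow> 0 \<le> hnorm H x"
  by (simp add: hnorm_def Re_ip_self_nonneg)

lemma ip_self: "x \<in> carrier H \<Longrightarrow> ip H x x = of_real ((hnorm H x)\<^sup>2)"
  using ip_commute[of x x] by (simp add: hnorm_sq complex_eq_iff)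

lemma hnorm_zero [simp]: "hnorm H 0 = 0"
  by (simp add: hnorm_def)

lemma hnorm_eq_0_iff [simp]: "x \<in> carrier H \<Longrightarrow> hnorm H x = 0 \<longleftrightarrow> x = 0"
  using ip_pos[of x] by (cases "x = 0") (auto simp: hnorm_def)

lemma hnorm_scaleC: "x \<in> carrier H \<Longrightarrow> hnorm H (a *\<^sub>C x) = cmod a * hnorm H x"
proof -
  assume x: "x \<in> carrier H"
  have "ip H (a *\<^sub>C x) (a *\<^sub>C x) = of_real ((cmod a * hnorm H x)\<^sup>2)"
    using x ip_self[OF x] complex_norm_square[of a]
    by (simp add: ip_scaleC_left ip_scaleC_right power_mult_distrib)
  then have "(hnorm H (a *\<^sub>C x))\<^sup>2 = (cmod a * hnorm H x)\<^sup>2"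
    using x by (simp only: hnorm_sq scale_mem Re_complex_of_real)
  then show ?thesis using x by simp
qed

lemma hnorm_minus_commute:
  assumes "x \<in> carrier H" "y \<in> carrier H"
  shows "hnorm H (x - y) = hnorm H (y - x)"
proof -
  have "(-1) *\<^sub>C (y - x) = x - y"
    using cvec.scale_minus_left[of 1 "y - x"] by simp
  then show ?thesis using hnorm_scaleC[of "y - x" "-1"] assms by simp
qed

lemma hnorm_diff_sq:
  assumes "x \<in> carrier H" "y \<in> carrier H"
  shows "(hnorm H (x - y))\<^sup>2 = (hnorm H x)\<^sup>2 - 2 * Re (ip H x y) + (hnorm H y)\<^sup>2"
  using assms ip_commute[of y x]
  by (simp add: hnorm_sq ip_diff_left ip_diff_right)

lemma hnorm_add_sq:
  assumes "x \<in> carrier H" "y \<in> carrier H"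
  shows "(hnorm H (x + y))\<^sup>2 = (hnorm H x)\<^sup>2 + 2 * Re (ip H x y) + (hnorm H y)\<^sup>2"
  using assms ip_commute[of y x]
  by (simp add: hnorm_sq ip_add_left ip_add_right)

lemma Cauchy_Schwarz:
  assumes x: "x \<in> carrier H" and y: "y \<in> carrier H"
  shows "cmod (ip H x y) \<le> hnorm H x * hnorm H y"
proof (cases "y = 0")
  case False
  define n where "n = (hnorm H y)\<^sup>2"
  define a where "a = ip H x y / of_real n"
  have n: "n > 0" using False y by (simp add: n_def)
  have "0 \<le> (hnorm H (x - a *\<^sub>C y))\<^sup>2" by simp
  also have "\<dots> = (hnorm H x)\<^sup>2 - 2 * Re (cnj a * ip H x y) + (cmod a)\<^sup>2 * n"
    using x y by (simp add: hnorm_diff_sq ip_scaleC_right hnorm_scaleC power_mult_distrib n_def)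
  also have "cnj a * ip H x y = of_real ((cmod (ip H x y))\<^sup>2 / n)"
    using complex_norm_square[of "ip H x y"] by (simp add: a_def mult.commute)
  also have "(cmod a)\<^sup>2 * n = (cmod (ip H x y))\<^sup>2 / n"
    using n by (simp add: a_def norm_divide power_divide power2_eq_square)
  finally have "(cmod (ip H x y))\<^sup>2 / n \<le> (hnorm H x)\<^sup>2" by simp
  then have "(cmod (ip H x y))\<^sup>2 \<le> (hnorm H x * hnorm H y)\<^sup>2"
    using n by (simp add: n_def divide_le_eq power_mult_distrib)
  then show ?thesis using x y by (simp add: power2_le_iff_abs_le)
qed (use assms in auto)

lemma hnorm_triangle:
  assumes x: "x \<in> carrier H" and y: "y \<in> carrier H"
  shows "hnorm H (x + y) \<le> hnorm H x + hnorm H y"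
proof -
  have "(hnorm H (x + y))\<^sup>2 \<le> (hnorm H x + hnorm H y)\<^sup>2"
    using Cauchy_Schwarz[OF x y] complex_Re_le_cmod[of "ip H x y"]
    by (simp add: hnorm_add_sq[OF x y] power2_sum)
  then show ?thesis using x y by (simp add: power2_le_iff_abs_le)
qed

lemma hnorm_triangle_diff:
  assumes "x \<in> carrier H" "y \<in> carrier H" "z \<in> carrier H"
  shows "hnorm H (x - z) \<le> hnorm H (x - y) + hnorm H (y - z)"
  using hnorm_triangle[of "x - y" "y - z"] assms by simp

lemma parallelogram:
  assumes "x \<in> carrier H" "y \<in> carrier H"
  shows "(hnorm H (x - y))\<^sup>2 + (hnorm H (x + y))\<^sup>2 = 2 * (hnorm H x)\<^sup>2 + 2 * (hnorm H y)\<^sup>2"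
  using assms by (simp add: hnorm_diff_sq hnorm_add_sq)

section \<open>Orthogonal projection by best approximation\<close>

lemma orthogonal_if_minimal:
  assumes x: "x \<in> carrier H" and u: "u \<in> carrier H"
    and min: "\<And>t. hnorm H x \<le> hnorm H (x - t *\<^sub>C u)"
  shows "ip H x u = 0"
proof (cases "u = 0")
  case False
  define n where "n = (hnorm H u)\<^sup>2"
  \<comment> \<open>The optimal coefficient: it lowers the squared norm of \<open>x\<close> by
    |<x,u>|^2 / |u|^2, an amount that minimality forces to be 0.\<close>
  define t where "t = ip H x u / of_real n"
  have n: "n > 0" using False u by (simp add: n_def)
  have "(hnorm H x)\<^sup>2 \<le> (hnorm H (x - t *\<^sub>C u))\<^sup>2"
    using min[of t] x by (intro power_mono) auto
  also have "\<dots> = (hnorm H x)\<^sup>2 - 2 * Re (cnj t * ip H x u) + (cmod t)\<^sup>2 * n"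
    using x u by (simp add: hnorm_diff_sq ip_scaleC_right hnorm_scaleC power_mult_distrib n_def)
  also have "cnj t * ip H x u = of_real ((cmod (ip H x u))\<^sup>2 / n)"
    using complex_norm_square[of "ip H x u"] by (simp add: t_def mult.commute)
  also have "(cmod t)\<^sup>2 * n = (cmod (ip H x u))\<^sup>2 / n"
    using n by (simp add: t_def norm_divide power_divide power2_eq_square)
  finally have "(cmod (ip H x u))\<^sup>2 / n \<le> 0" by simp
  then show ?thesis using n by (simp add: divide_le_0_iff)
qed (use x in simp)

text \<open>A minimizing sequence in \<open>W\<close> is Cauchy by the parallelogram law, and its
  limit is a nearest point, so the residual is orthogonal to \<open>W\<close>. As \<open>W\<close>
  may fail to be closed, the limit is only known to lie in its closure.\<close>

lemma projection_closure_exists: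
  assumes W: "cvec.subspace W" "W \<subseteq> carrier H" and x: "x \<in> carrier H"
  shows "\<exists>y\<in>hclosure H W. \<forall>u\<in>W. ip H (x - y) u = 0"
proof -
  define d where "d = (INF y\<in>W. (hnorm H (x - y))\<^sup>2)"
  have bdd: "bdd_below ((\<lambda>y. (hnorm H (x - y))\<^sup>2) ` W)"
    by (rule bdd_belowI[of _ 0]) auto
  have W0: "0 \<in> W" using W(1) by (rule cvec.subspace_0)
  have d_le: "d \<le> (hnorm H (x - y))\<^sup>2" if "y \<in> W" for y
    unfolding d_def using bdd that by (rule cINF_lower)
  have "\<exists>y\<in>W. (hnorm H (x - y))\<^sup>2 < d + 1 / real (Suc n)" for n
  proof -
    have "d < d + 1 / real (Suc n)" by simp
    then show ?thesis unfolding d_def using cINF_less_iff[OF _ bdd] W0 by blast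
  qed
  then obtain s where s: "\<And>n. s n \<in> W" "\<And>n. (hnorm H (x - s n))\<^sup>2 < d + 1 / real (Suc n)"
    by metis
  have sH: "s n \<in> carrier H" for n using s(1) W(2) by blast
  have dist: "(hnorm H (s m - s n))\<^sup>2 \<le> 2 / real (Suc m) + 2 / real (Suc n)" for m n
  proof -
    \<comment> \<open>The midpoint of two terms is again in \<open>W\<close>, hence at squared
      distance at least \<open>d\<close> from \<open>x\<close>; the parallelogram law turns this
      into a bound on the distance between the terms.\<close>
    define h where "h = (1/2) *\<^sub>C (s m + s n)"
    have h: "h \<in> W" unfolding h_def using s(1) W(1) by (simp add: cvec.subspace_add cvec.subspace_scale)
    have "(x - s n) + (x - s m) = 2 *\<^sub>C (x - h)"
    proof -
      have two: "2 *\<^sub>C y = y + y" for y :: 'a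
        using scaleC_add_left[of 1 1 y] by (simp add: scaleC_one)
      have "2 *\<^sub>C h = s m + s n"
        unfolding h_def by (simp add: scaleC_scaleC scaleC_one)
      then show ?thesis by (simp add: cvec.scale_right_diff_distrib two[of x])
    qed
    moreover have "(x - s n) - (x - s m) = s m - s n" by simp
    ultimately have "(hnorm H (s m - s n))\<^sup>2 + (hnorm H (2 *\<^sub>C (x - h)))\<^sup>2
        = 2 * (hnorm H (x - s n))\<^sup>2 + 2 * (hnorm H (x - s m))\<^sup>2"
      using parallelogram[of "x - s n" "x - s m"] sH x by simp
    moreover have "(hnorm H (2 *\<^sub>C (x - h)))\<^sup>2 = 4 * (hnorm H (x - h))\<^sup>2"
      using h W(2) x by (subst hnorm_scaleC) (auto simp: power_mult_distrib)
    ultimately show ?thesis using d_le[OF h] s(2)[of m] s(2)[of n] by simp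
  qed
  have "\<exists>y\<in>carrier H. (\<lambda>n. hnorm H (s n - y)) \<longlonglongrightarrow> 0"
  proof (rule complete)
    fix e :: real assume e: "e > 0"
    obtain N where N: "1 / real (Suc N) < e\<^sup>2 / 4"
      using e by (metis nat_approx_posE zero_less_divide_iff zero_less_numeral zero_less_power)
    have "hnorm H (s m - s n) < e" if "m \<ge> N" "n \<ge> N" for m n
    proof -
      have "1 / real (Suc m) \<le> 1 / real (Suc N)" "1 / real (Suc n) \<le> 1 / real (Suc N)"
        using that by (simp_all add: frac_le)
      then have "(hnorm H (s m - s n))\<^sup>2 < e\<^sup>2" using dist[of m n] N by simp
      then show ?thesis using e by (simp add: power_less_imp_less_base)
    qed
    then show "\<exists>N. \<forall>m\<ge>N. \<forall>n\<ge>N. hnorm H (s m - s n) < e" by blast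
  qed (rule sH)
  then obtain y where y: "y \<in> carrier H" and lim: "(\<lambda>n. hnorm H (s n - y)) \<longlonglongrightarrow> 0" by blast
  have "y \<in> hclosure H W"
    unfolding hclosure_def
  proof (intro CollectI conjI allI impI y)
    fix e :: real assume "e > 0"
    then obtain n where "hnorm H (s n - y) < e"
      using order_tendstoD(2)[OF lim] eventually_happens'[OF sequentially_bot] by blast
    then show "\<exists>u\<in>W. hnorm H (y - u) < e"
      using s(1) hnorm_minus_commute[OF y sH] by metis
  qed
  moreover have "ip H (x - y) u = 0" if u: "u \<in> W" for u
  proof (rule orthogonal_if_minimal)
    show "x - y \<in> carrier H" "u \<in> carrier H" using x y u W(2) by auto
    fix t
    have uH: "u \<in> carrier H" using u W(2) by blast
    have upper: "hnorm H (x - y) \<le> sqrt d"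
    proof (rule LIMSEQ_le_const)
      have "(\<lambda>n. sqrt (d + 1 / real (Suc n)) + hnorm H (s n - y)) \<longlonglongrightarrow> sqrt (d + 0) + 0"
        by (intro tendsto_intros lim LIMSEQ_Suc[OF lim_1_over_n])
      then show "(\<lambda>n. sqrt (d + 1 / real (Suc n)) + hnorm H (s n - y)) \<longlonglongrightarrow> sqrt d" by simp
      have "hnorm H (x - y) \<le> sqrt (d + 1 / real (Suc n)) + hnorm H (s n - y)" for n
      proof -
        have "hnorm H (x - s n) \<le> sqrt (d + 1 / real (Suc n))"
          using s(2)[of n] by (intro real_le_rsqrt) simp
        then show ?thesis using hnorm_triangle_diff[OF x sH[of n] y] by simp
      qed
      then show "\<exists>N. \<forall>n\<ge>N. hnorm H (x - y) \<le> sqrt (d + 1 / real (Suc n)) + hnorm H (s n - y)"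
        by blast
    qed
    \<comment> \<open>Since \<open>y\<close> may lie outside \<open>W\<close>, the comparison with
      \<open>d\<close> is made at \<open>s n + t *\<^sub>C u\<close> and passed to the
      limit.\<close>
    have "sqrt d \<le> hnorm H (x - y - t *\<^sub>C u)"
    proof (rule LIMSEQ_le_const)
      have "(\<lambda>n. hnorm H (x - y - t *\<^sub>C u) + hnorm H (s n - y)) \<longlonglongrightarrow> hnorm H (x - y - t *\<^sub>C u) + 0"
        by (intro tendsto_intros lim)
      then show "(\<lambda>n. hnorm H (x - y - t *\<^sub>C u) + hnorm H (s n - y)) \<longlonglongrightarrow> hnorm H (x - y - t *\<^sub>C u)"
        by simp
      have "sqrt d \<le> hnorm H (x - y - t *\<^sub>C u) + hnorm H (s n - y)" for n
      proof -
        have "s n + t *\<^sub>C u \<in> W" using s(1) u W(1) by (simp add: cvec.subspace_add cvec.subspace_scale)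
        then have "sqrt d \<le> hnorm H (x - (s n + t *\<^sub>C u))"
          using d_le x W(2) by (intro real_le_lsqrt) auto
        also have "x - (s n + t *\<^sub>C u) = (x - y - t *\<^sub>C u) + (y - s n)" by simp
        also have "hnorm H \<dots> \<le> hnorm H (x - y - t *\<^sub>C u) + hnorm H (y - s n)"
          using x y uH sH by (intro hnorm_triangle) auto
        finally show ?thesis using hnorm_minus_commute[OF y sH[of n]] by simp
      qed
      then show "\<exists>N. \<forall>n\<ge>N. sqrt d \<le> hnorm H (x - y - t *\<^sub>C u) + hnorm H (s n - y)" by blast
    qed
    with upper show "hnorm H (x - y) \<le> hnorm H (x - y - t *\<^sub>C u)" by simp
  qed
  ultimately show ?thesis by blast
qed

text \<open>Closedness puts the nearest point in \<open>I\<close>. Two candidates differ by a vector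
  of \<open>I\<close> that is orthogonal to itself, so the definite description is
  determined.\<close>

lemma orth_proj:
  assumes I: "cvec.subspace I" "I \<subseteq> carrier H" "hclosure H I = I" and x: "x \<in> carrier H"
  shows orth_proj_mem: "orth_proj H I x \<in> I"
    and orth_proj_orth: "u \<in> I \<Longrightarrow> ip H (x - orth_proj H I x) u = 0"
proof -
  have ex: "\<exists>!y. y \<in> I \<and> (\<forall>u\<in>I. ip H (x - y) u = 0)"
  proof -
    obtain y where y: "y \<in> I" "\<forall>u\<in>I. ip H (x - y) u = 0"
      using projection_closure_exists[OF I(1,2) x] I(3) by auto
    moreover have "y' = y" if y': "y' \<in> I" "\<forall>u\<in>I. ip H (x - y') u = 0" for y'
    proof -
      have mem: "y \<in> carrier H" "y' \<in> carrier H" "y' - y \<in> carrier H"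
        using y(1) y'(1) I(2) diff_mem[of y' y] by blast+
      have "y' - y \<in> I" using y y' I(1) by (simp add: cvec.subspace_diff)
      then have "ip H (x - y) (y' - y) - ip H (x - y') (y' - y) = 0" using y y' by simp
      also have "ip H (x - y) (y' - y) - ip H (x - y') (y' - y) = ip H (y' - y) (y' - y)"
        using x mem by (simp add: ip_diff_left)
      finally show ?thesis
        using mem ip_pos[of "y' - y"] by (cases "y' = y") auto
    qed
    ultimately show ?thesis by blast
  qed
  from theI'[OF ex] show "orth_proj H I x \<in> I" "u \<in> I \<Longrightarrow> ip H (x - orth_proj H I x) u = 0"
    unfolding orth_proj_def by auto
qed

end


section \<open>Multipliers of the Szego and Bergman kernels\<close>

lemma one_minus_mult_cnj_neq_0:
  fixes s w :: complex
  assumes "cmod s \<le> 1" "cmod w < 1"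
  shows "1 - s * cnj w \<noteq> 0"
proof
  assume "1 - s * cnj w = 0"
  then have "cmod (s * cnj w) = 1" by (metis eq_iff_diff_eq_0 norm_one)
  moreover have "cmod (s * cnj w) \<le> cmod w"
    using assms(1) mult_right_mono[of "cmod s" 1 "cmod w"] by (simp add: norm_mult)
  ultimately show False using assms(2) by simp
qed

text \<open>Cauchy's integral formula on the unit circle: there the conjugate of
  \<open>cis t\<close> is its inverse, so \<open>cis t / (cis t - w)\<close> is the conjugate of the
  Szego kernel. The measure is not normalized, whence the factor 2 pi.\<close>

lemma Szego_reproducing:
  fixes F :: "complex \<Rightarrow> complex"
  assumes F: "continuous_on (cball 0 1) F" "F holomorphic_on \<D>" and w: "w \<in> \<D>"
  shows "((\<lambda>t. F (cis t) * cnj (1 / (1 - cis t * cnj w))) has_integral 2 * pi * F w) {0..2 * pi}"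
proof -
  have "((\<lambda>u. F u / (u - w)) has_contour_integral (2 * of_real pi * \<i> * F w)) (circlepath 0 1)"
    using F w by (intro Cauchy_integral_circlepath) auto
  then have "((\<lambda>t. F (cis t) / (cis t - w) * \<i> * cis t) has_integral (2 * of_real pi * \<i> * F w))
      {0..2 * pi}"
    unfolding circlepath_def by (subst (asm) has_contour_integral_part_circlepath_iff) auto
  \<comment> \<open>The factor -i cancels the i that comes from du = i u dt.\<close>
  then have "((\<lambda>t. F (cis t) / (cis t - w) * \<i> * cis t * (-\<i>)) has_integral
      (2 * of_real pi * \<i> * F w) * (-\<i>)) {0..2 * pi}"
    by (rule has_integral_mult_left)
  moreover have "F (cis t) / (cis t - w) * \<i> * cis t * (-\<i>)
      = F (cis t) * cnj (1 / (1 - cis t * cnj w))" for t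
  proof -
    have "cnj (cis t) * cis t = 1" by (simp add: cis_cnj cis_mult)
    then have "(1 - cnj (cis t) * w) * cis t = cis t - w"
      by (simp add: algebra_simps)
    moreover have "cis t \<noteq> 0" by simp
    ultimately have "cis t / (cis t - w) = 1 / (1 - cnj (cis t) * w)"
      by (metis mult_cancel_right1 nonzero_mult_divide_mult_cancel_right)
    moreover have "F (cis t) / (cis t - w) * \<i> * cis t * (-\<i>) = F (cis t) * (cis t / (cis t - w))"
      by (simp add: mult_ac)
    ultimately show ?thesis by (simp add: mult.commute)
  qed
  ultimately show ?thesis by (simp add: algebra_simps)
qed

lemma Szego_reproducing_lincomb:
  fixes F :: "complex \<Rightarrow> complex"
  assumes F: "continuous_on (cball 0 1) F" "F holomorphic_on \<D>" and A: "finite A" "A \<subseteq> \<D>"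
  shows "((\<lambda>t. F (cis t) * cnj (\<Sum>w\<in>A. c w / (1 - cis t * cnj w))) has_integral
    2 * pi * (\<Sum>w\<in>A. cnj (c w) * F w)) {0..2 * pi}"
proof -
  have "((\<lambda>t. \<Sum>w\<in>A. F (cis t) * cnj (1 / (1 - cis t * cnj w)) * cnj (c w)) has_integral
      (\<Sum>w\<in>A. 2 * pi * F w * cnj (c w))) {0..2 * pi}"
    using A by (intro has_integral_sum has_integral_mult_left Szego_reproducing F) auto
  then show ?thesis
    by (simp add: sum_distrib_left mult.assoc mult.commute[of "cnj (c _)"])
qed

text \<open>
  With \<open>f\<close> and \<open>g\<close> the combinations of Szego kernels with coefficients \<open>c w\<close> and \<open>c w * cnj (q w)\<close>, the
  mean value over the circle of \<open>\<bar>q g - B\<^sup>2 f\<bar>\<^sup>2 \<ge> 0\<close> gives the inequality, as the reproducing property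
  evaluates all the terms.
\<close>

lemma Szego_multiplier_bound:
  assumes q: "continuous_on (cball 0 1) q" "q holomorphic_on \<D>"
    and B: "\<And>z. z \<in> cball 0 1 \<Longrightarrow> cmod (q z) \<le> B" "B > 0"
    and A: "finite A" "A \<subseteq> \<D>"
  shows "Re (\<Sum>w\<in>A. \<Sum>v\<in>A. c w * cnj (q w) * cnj (c v * cnj (q v)) / (1 - v * cnj w))
    \<le> B\<^sup>2 * Re (\<Sum>w\<in>A. \<Sum>v\<in>A. c w * cnj (c v) / (1 - v * cnj w))"
proof -
  define comb where "comb = (\<lambda>c s. \<Sum>w\<in>A. c w / (1 - s * cnj w))"
  define Q where "Q = (\<lambda>c. \<Sum>w\<in>A. \<Sum>v\<in>A. c w * cnj (c v) / (1 - v * cnj w))"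
  have neq: "1 - s * cnj w \<noteq> 0" if "s \<in> cball 0 1" "w \<in> A" for s w
    using that A(2) by (intro one_minus_mult_cnj_neq_0) auto
  have comb_cont: "continuous_on (cball 0 1) (comb d)"
    and comb_hol: "comb d holomorphic_on \<D>" for d
    unfolding comb_def using neq by (force intro!: continuous_intros holomorphic_intros)+
  define d where "d = (\<lambda>w. c w * cnj (q w))"
  let ?f = "comb c" and ?g = "comb d"
  have swap: "(\<Sum>v\<in>A. cnj (e' v) * comb e v) = (\<Sum>w\<in>A. \<Sum>v\<in>A. e w * cnj (e' v) / (1 - v * cnj w))"
    for e e'
    unfolding comb_def sum_distrib_left
    by (subst sum.swap) (simp add: mult.commute)
  have ff: "((\<lambda>t. ?f (cis t) * cnj (?f (cis t))) has_integral 2 * pi * Q c) {0..2 * pi}"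
    using Szego_reproducing_lincomb[OF comb_cont comb_hol A, of c c]
    by (simp only: swap) (simp only: comb_def Q_def)
  have gg: "((\<lambda>t. ?g (cis t) * cnj (?g (cis t))) has_integral 2 * pi * Q d) {0..2 * pi}"
    using Szego_reproducing_lincomb[OF comb_cont comb_hol A, of d d]
    by (simp only: swap) (simp only: comb_def Q_def)
  \<comment> \<open>Pairing with \<open>?f\<close> evaluates \<open>q\<close> at the points of
    \<open>A\<close>, where its values are absorbed by \<open>d\<close>. The mixed term therefore
    has the same integral as the square of |\<open>?g\<close>|.\<close>
  have "((\<lambda>t. (q (cis t) * ?g (cis t)) * cnj (?f (cis t))) has_integral
      2 * pi * (\<Sum>v\<in>A. cnj (c v) * (q v * ?g v))) {0..2 * pi}"
    using Szego_reproducing_lincomb[of "\<lambda>z. q z * ?g z" A c] q A comb_cont[of d] comb_hol[of d]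
    by (simp add: continuous_on_mult holomorphic_on_mult comb_def)
  also have "(\<Sum>v\<in>A. cnj (c v) * (q v * ?g v)) = (\<Sum>v\<in>A. cnj (d v) * ?g v)"
    by (simp add: d_def mult.assoc)
  also have "\<dots> = Q d" by (simp only: swap) (simp only: Q_def)
  finally have gf: "((\<lambda>t. (q (cis t) * ?g (cis t)) * cnj (?f (cis t))) has_integral 2 * pi * Q d)
      {0..2 * pi}" .
  \<comment> \<open>\<open>Re (J t)\<close> dominates |q g - B^2 f|^2, with |q|^2 replaced by its
    bound B^2 so that every term has a known integral. The total is 2 pi B^2 (B^2 \<open>Q c\<close>
    - \<open>Q d\<close>).\<close>
  define J where "J = (\<lambda>t. of_real (B\<^sup>2) * (?g (cis t) * cnj (?g (cis t)))
      - of_real (2 * B\<^sup>2) * ((q (cis t) * ?g (cis t)) * cnj (?f (cis t)))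
      + of_real (B ^ 4) * (?f (cis t) * cnj (?f (cis t))))"
  have "(J has_integral of_real (B\<^sup>2) * (2 * pi * Q d) - of_real (2 * B\<^sup>2) * (2 * pi * Q d)
      + of_real (B ^ 4) * (2 * pi * Q c)) {0..2 * pi}"
    unfolding J_def by (intro has_integral_add has_integral_diff has_integral_mult_right ff gg gf)
  then have int: "((\<lambda>t. Re (J t)) has_integral Re (of_real (B\<^sup>2) * (2 * pi * Q d)
      - of_real (2 * B\<^sup>2) * (2 * pi * Q d) + of_real (B ^ 4) * (2 * pi * Q c))) {0..2 * pi}"
    by (rule has_integral_Re)
  have "0 \<le> Re (J t)" for t
  proof -
    let ?q = "q (cis t)" and ?u = "?g (cis t)" and ?v = "?f (cis t)"
    have "0 \<le> (cmod (?q * ?u - of_real (B\<^sup>2) * ?v))\<^sup>2" by simp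
    also have "\<dots> = (cmod ?q)\<^sup>2 * (cmod ?u)\<^sup>2 - 2 * B\<^sup>2 * Re (?q * ?u * cnj ?v) + B ^ 4 * (cmod ?v)\<^sup>2"
    proof -
      have expand: "(cmod (a - of_real b * v))\<^sup>2 = (cmod a)\<^sup>2 - 2 * b * Re (a * cnj v) + b\<^sup>2 * (cmod v)\<^sup>2"
        for a v :: complex and b :: real
        unfolding cmod_power2 by (simp add: power2_eq_square algebra_simps)
      show ?thesis unfolding expand by (simp add: norm_mult power_mult_distrib)
    qed
    also have "(cmod ?q)\<^sup>2 * (cmod ?u)\<^sup>2 \<le> B\<^sup>2 * (cmod ?u)\<^sup>2"
      using B(1)[of "cis t"] by (intro mult_right_mono power_mono) auto
    finally have "0 \<le> B\<^sup>2 * (cmod ?u)\<^sup>2 - 2 * B\<^sup>2 * Re (?q * ?u * cnj ?v) + B ^ 4 * (cmod ?v)\<^sup>2"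
      by simp
    moreover have "J t = of_real (B\<^sup>2) * of_real ((cmod ?u)\<^sup>2) - of_real (2 * B\<^sup>2) * (?q * ?u * cnj ?v)
        + of_real (B ^ 4) * of_real ((cmod ?v)\<^sup>2)"
      unfolding J_def complex_norm_square ..
    ultimately show ?thesis by (simp del: of_real_power of_real_mult)
  qed
  then have "0 \<le> Re (of_real (B\<^sup>2) * (2 * pi * Q d)
      - of_real (2 * B\<^sup>2) * (2 * pi * Q d) + of_real (B ^ 4) * (2 * pi * Q c))"
    by (intro has_integral_nonneg[OF int]) auto
  also have "\<dots> = 2 * pi * B\<^sup>2 * (B\<^sup>2 * Re (Q c) - Re (Q d))"
    by (simp add: algebra_simps power2_eq_square power4_eq_xxxx)
  finally have "0 \<le> 2 * pi * B\<^sup>2 * (B\<^sup>2 * Re (Q c) - Re (Q d))" .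
  moreover have "0 < 2 * pi * B\<^sup>2" using B(2) by simp
  ultimately have "0 \<le> B\<^sup>2 * Re (Q c) - Re (Q d)" by (meson mult_pos_neg not_less)
  then show ?thesis by (simp add: Q_def d_def)
qed

text \<open>\<open>1 / (1 - t)\<^sup>2\<close> is the sum of the \<open>t\<^sup>n / (1 - t)\<close>, and each term is a rescaled Szego form.\<close>

lemma Bergman_multiplier_bound:
  assumes q: "continuous_on (cball 0 1) q" "q holomorphic_on \<D>"
    and B: "\<And>z. z \<in> cball 0 1 \<Longrightarrow> cmod (q z) \<le> B" "B > 0"
    and A: "finite A" "A \<subseteq> \<D>"
  shows "Re (\<Sum>w\<in>A. \<Sum>v\<in>A. c w * cnj (q w) * cnj (c v * cnj (q v)) * bergman_kernel v w)
    \<le> B\<^sup>2 * Re (\<Sum>w\<in>A. \<Sum>v\<in>A. c w * cnj (c v) * bergman_kernel v w)"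
proof -
  have geo: "(\<lambda>n. (d w * cnj w ^ n) * cnj (d v * cnj v ^ n) / (1 - v * cnj w))
      sums (d w * cnj (d v) * bergman_kernel v w)" if "w \<in> A" "v \<in> A" for d w v
  proof -
    have "cmod v * cmod w < 1 * 1"
      using that A(2) by (intro mult_strict_mono') auto
    then have "(\<lambda>n. (v * cnj w) ^ n) sums (1 / (1 - v * cnj w))"
      by (intro geometric_sums) (simp add: norm_mult)
    from sums_mult[OF this, of "d w * cnj (d v) / (1 - v * cnj w)"] show ?thesis
      by (simp add: bergman_kernel_def power2_eq_square power_mult_distrib algebra_simps)
  qed
  have S: "(\<lambda>n. Re (\<Sum>w\<in>A. \<Sum>v\<in>A. (d w * cnj w ^ n) * cnj (d v * cnj v ^ n) / (1 - v * cnj w)))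
      sums Re (\<Sum>w\<in>A. \<Sum>v\<in>A. d w * cnj (d v) * bergman_kernel v w)" for d
    using geo by (intro sums_Re sums_sum)
  show ?thesis
  proof (rule sums_le[OF _ S sums_mult[OF S]])
    fix n
    show "Re (\<Sum>w\<in>A. \<Sum>v\<in>A. c w * cnj (q w) * cnj w ^ n * cnj (c v * cnj (q v) * cnj v ^ n) / (1 - v * cnj w))
      \<le> B\<^sup>2 * Re (\<Sum>w\<in>A. \<Sum>v\<in>A. c w * cnj w ^ n * cnj (c v * cnj v ^ n) / (1 - v * cnj w))"
      using Szego_multiplier_bound[OF q B A, of "\<lambda>w. c w * cnj w ^ n"]
      by (simp add: mult_ac)
  qed
qed

section \<open>Density of kernel functions and Shimorin's inequality\<close>

context analytic_rkhs
begin

abbreviation kernel_fun :: "complex \<Rightarrow> complex \<Rightarrow> complex"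
  where "kernel_fun w \<equiv> on_disk (\<lambda>z. K z w)"

lemma ip_kernel_kernel:
  assumes "w \<in> \<D>" "v \<in> \<D>"
  shows "ip H (kernel_fun w) (kernel_fun v) = K v w"
  using reproducing[OF kernel_mem[OF assms(1)] assms(2)] assms by (simp add: on_disk_def)

lemma lincomb_kernel_mem:
  "A \<subseteq> \<D> \<Longrightarrow> (\<Sum>w\<in>A. c w *\<^sub>C kernel_fun w) \<in> carrier H"
  using kernel_mem by (auto intro!: sum_mem scale_mem)

lemma ip_lincomb_kernel:
  assumes "A \<subseteq> \<D>" "f \<in> carrier H"
  shows "ip H f (\<Sum>w\<in>A. c w *\<^sub>C kernel_fun w) = (\<Sum>w\<in>A. cnj (c w) * f w)"
  using assms kernel_mem
  by (subst ip_sum_right) (auto simp: ip_scaleC_right reproducing intro!: sum.cong)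

lemma hnorm_lincomb_kernel:
  assumes "A \<subseteq> \<D>"
  shows "(hnorm H (\<Sum>w\<in>A. c w *\<^sub>C kernel_fun w))\<^sup>2 = Re (\<Sum>w\<in>A. \<Sum>v\<in>A. c w * cnj (c v) * K v w)"
  using assms kernel_mem
  by (simp add: hnorm_sq lincomb_kernel_mem ip_lincomb_self subset_iff ip_kernel_kernel
      del: Re_sum)

text \<open>Continuity at 0 supplies the one missing value in the disk; off the disk members of the
  space vanish by convention.\<close>

lemma eq_zero_if_vanishes_off_0:
  assumes g: "g \<in> carrier H" and zero: "\<And>w. w \<in> \<D> - {0} \<Longrightarrow> g w = 0"
  shows "g = 0"
proof -
  have "isCont g 0"
    using holomorphic_on_imp_continuous_on[OF holomorphic[OF g]]
    by (simp add: continuous_on_eq_continuous_at)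
  then have lim: "(g \<longlongrightarrow> g 0) (at 0)" by (simp add: isCont_def)
  have "eventually (\<lambda>w. w \<in> \<D> - {0}) (at (0::complex))"
    using eventually_at_in_open[of \<D> 0] by simp
  then have "(g \<longlongrightarrow> 0) (at 0)"
    by (intro tendsto_eventually) (auto elim!: eventually_mono simp: zero)
  then have "g 0 = 0" using tendsto_unique[OF _ lim] by simp
  then have "g w = 0" for w using zero[of w] vanishes[OF g, of w] by blast
  then show ?thesis by (simp add: fun_eq_iff)
qed

text \<open>The point \<open>0\<close> is excluded so that coefficients can later be divided by the points.\<close>

lemma lincomb_kernel_dense:
  assumes f: "f \<in> carrier H" and e: "e > 0"
  shows "\<exists>A c. finite A \<and> A \<subseteq> \<D> - {0} \<and> hnorm H (f - (\<Sum>w\<in>A. c w *\<^sub>C kernel_fun w)) < e"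
proof -
  define comb where "comb = (\<lambda>A c. \<Sum>w\<in>A. c w *\<^sub>C kernel_fun w)"
  define W where "W = {comb A c | A c. finite A \<and> A \<subseteq> \<D> - {0}}"
  \<comment> \<open>Padding coefficients with 0 brings two combinations to a common index set, so
    that they can be added.\<close>
  have extend: "comb A c = comb B (\<lambda>w. if w \<in> A then c w else 0)" if "finite B" "A \<subseteq> B" for A B c
    unfolding comb_def using that by (intro sum.mono_neutral_cong_left) auto
  have W: "cvec.subspace W"
  proof (rule cvec.subspaceI)
    show "0 \<in> W" unfolding W_def comb_def by (auto intro!: exI[of _ "{}"])
  next
    fix x y assume "x \<in> W" "y \<in> W"
    then obtain A c B d where A: "finite A" "A \<subseteq> \<D> - {0}" "x = comb A c"
      and B: "finite B" "B \<subseteq> \<D> - {0}" "y = comb B d"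
      unfolding W_def by blast
    have "x + y = comb (A \<union> B) (\<lambda>w. if w \<in> A then c w else 0) + comb (A \<union> B) (\<lambda>w. if w \<in> B then d w else 0)"
      using extend[of "A \<union> B" A c] extend[of "A \<union> B" B d] A B by simp
    also have "\<dots> = comb (A \<union> B) (\<lambda>w. (if w \<in> A then c w else 0) + (if w \<in> B then d w else 0))"
      unfolding comb_def by (simp add: scaleC_add_left sum.distrib)
    finally show "x + y \<in> W" unfolding W_def using A B by blast
  next
    fix a x assume "x \<in> W"
    then obtain A c where A: "finite A" "A \<subseteq> \<D> - {0}" "x = comb A c"
      unfolding W_def by blast
    have "a *\<^sub>C x = comb A (\<lambda>w. a * c w)"
      unfolding A(3) comb_def by (simp add: cvec.scale_sum_right)
    then show "a *\<^sub>C x \<in> W" unfolding W_def using A by blast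
  qed
  have WH: "W \<subseteq> carrier H"
    unfolding W_def comb_def by (blast intro: lincomb_kernel_mem)
  obtain y where y: "y \<in> hclosure H W" "\<forall>u\<in>W. ip H (f - y) u = 0"
    using projection_closure_exists[OF W WH f] by blast
  have yH: "y \<in> carrier H" using y(1) by (simp add: hclosure_def)
  \<comment> \<open>The residual is orthogonal to every kernel function in \<open>W\<close>, so the
    reproducing property makes it vanish on the punctured disk.\<close>
  have "f - y = 0"
  proof (rule eq_zero_if_vanishes_off_0)
    fix w assume w: "w \<in> \<D> - {0}"
    have "kernel_fun w = comb {w} (\<lambda>_. 1)" by (simp add: comb_def scaleC_one)
    then have "kernel_fun w \<in> W" unfolding W_def using w by blast
    then show "(f - y) w = 0"
      using y(2) reproducing[of "f - y" w] f yH w by auto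
  qed (use f yH in simp)
  then have "f = y" by simp
  moreover obtain u where "u \<in> W" "hnorm H (y - u) < e"
    using y(1) e unfolding hclosure_def by blast
  ultimately show ?thesis unfolding W_def comb_def by blast
qed

text \<open>Duality: the norm is attained by pairing \<open>x\<close> with itself, and by density a
  kernel combination close to \<open>x\<close> can stand in for the second argument.\<close>

lemma hnorm_le_if_lincomb_kernel:
  assumes x: "x \<in> carrier H" and B: "B \<ge> 0"
    and bound: "\<And>A c. \<lbrakk>finite A; A \<subseteq> \<D> - {0}\<rbrakk> \<Longrightarrow>
      cmod (ip H x (\<Sum>w\<in>A. c w *\<^sub>C kernel_fun w)) \<le> B * hnorm H (\<Sum>w\<in>A. c w *\<^sub>C kernel_fun w)"
  shows "hnorm H x \<le> B"
proof (rule ccontr)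
  assume "\<not> hnorm H x \<le> B"
  then have less: "B < hnorm H x" by simp
  \<comment> \<open>With this tolerance the total error \<open>e * (hnorm H x + B)\<close> is
    exactly half of \<open>hnorm H x * (hnorm H x - B)\<close>, which it would have to exceed or
    equal.\<close>
  define e where "e = hnorm H x * (hnorm H x - B) / (2 * (hnorm H x + B))"
  have e: "e > 0" unfolding e_def using less B by (simp add: divide_pos_pos)
  obtain A c where A: "finite A" "A \<subseteq> \<D> - {0}" "hnorm H (x - (\<Sum>w\<in>A. c w *\<^sub>C kernel_fun w)) < e"
    using lincomb_kernel_dense[OF x e] by blast
  define f where "f = (\<Sum>w\<in>A. c w *\<^sub>C kernel_fun w)"
  define r where "r = hnorm H (x - f)"
  have f: "f \<in> carrier H" unfolding f_def using A(2) by (intro lincomb_kernel_mem) auto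
  have "(hnorm H x)\<^sup>2 = cmod (ip H x x)" using x by (simp add: ip_self norm_power)
  also have "\<dots> = cmod (ip H x (x - f) + ip H x f)" using x f by (simp add: ip_diff_right)
  also have "\<dots> \<le> cmod (ip H x (x - f)) + cmod (ip H x f)" by (rule norm_triangle_ineq)
  also have "cmod (ip H x (x - f)) \<le> hnorm H x * r"
    unfolding r_def using x f by (intro Cauchy_Schwarz) auto
  also have "cmod (ip H x f) \<le> B * hnorm H f" unfolding f_def using A by (intro bound)
  also have "hnorm H f \<le> hnorm H x + r"
    unfolding r_def using hnorm_triangle[of "f - x" x] hnorm_minus_commute[OF x f] x f by simp
  finally have "(hnorm H x)\<^sup>2 \<le> hnorm H x * r + B * (hnorm H x + r)"
    using B by (simp add: mult_left_mono)
  also have "\<dots> \<le> hnorm H x * e + B * (hnorm H x + e)"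
    using A(3) B x unfolding r_def f_def by (intro add_mono mult_left_mono) auto
  finally have "hnorm H x * (hnorm H x - B) \<le> e * (hnorm H x + B)"
    by (simp add: power2_eq_square algebra_simps)
  also have "\<dots> = hnorm H x * (hnorm H x - B) / 2"
    unfolding e_def using add_pos_nonneg[of "hnorm H x" B] less B by (simp add: field_simps)
  finally have "hnorm H x * (hnorm H x - B) \<le> 0" by simp
  moreover have "0 < hnorm H x * (hnorm H x - B)" using less B by (intro mult_pos_pos) auto
  ultimately show False by simp
qed

text \<open>Against a kernel combination, pairing is a finite sum of point values; the uniform norm
  bound extends the convergence to all \<open>g\<close> by density.\<close>

lemma ip_tendsto_if_pointwise:
  assumes f: "\<And>n. f n \<in> carrier H" "\<And>n. hnorm H (f n) \<le> B" and f': "f' \<in> carrier H"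
    and lim: "\<And>w. w \<in> \<D> \<Longrightarrow> (\<lambda>n. f n w) \<longlonglongrightarrow> f' w" and g: "g \<in> carrier H"
  shows "(\<lambda>n. ip H (f n) g) \<longlonglongrightarrow> ip H f' g"
proof (rule tendstoI)
  fix e :: real assume e: "e > 0"
  \<comment> \<open>A bound for \<open>hnorm H (f n - f')\<close>; the summand 1 keeps it positive
    as a divisor.\<close>
  define M where "M = \<bar>B\<bar> + hnorm H f' + 1"
  have M: "M > 0" unfolding M_def using f' by (simp add: add_nonneg_pos)
  obtain A c where A: "finite A" "A \<subseteq> \<D> - {0}"
    and near: "hnorm H (g - (\<Sum>w\<in>A. c w *\<^sub>C kernel_fun w)) < e / (2 * M)"
    using lincomb_kernel_dense[OF g, of "e / (2 * M)"] e M by auto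
  let ?h = "\<Sum>w\<in>A. c w *\<^sub>C kernel_fun w"
  have h: "?h \<in> carrier H" using A(2) by (intro lincomb_kernel_mem) auto
  have AD: "A \<subseteq> \<D>" using A(2) by blast
  have "(\<lambda>n. ip H (f n) ?h) \<longlonglongrightarrow> ip H f' ?h"
    unfolding ip_lincomb_kernel[OF AD f(1)] ip_lincomb_kernel[OF AD f']
    using AD by (intro tendsto_intros lim) auto
  then have "\<forall>\<^sub>F n in sequentially. dist (ip H (f n) ?h) (ip H f' ?h) < e / 2"
    using e by (intro tendstoD) auto
  then show "\<forall>\<^sub>F n in sequentially. dist (ip H (f n) g) (ip H f' g) < e"
  proof eventually_elim
    case (elim n)
    have diff: "hnorm H (f n - f') \<le> M"
      using hnorm_triangle_diff[OF f(1)[of n] zero_mem f'] hnorm_minus_commute[OF zero_mem f'] f(2)[of n]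
      unfolding M_def by simp
    have "ip H (f n) g - ip H f' g = ip H (f n - f') (g - ?h) + (ip H (f n) ?h - ip H f' ?h)"
      using f(1) f' g h by (simp add: ip_diff_left ip_diff_right)
    then have "dist (ip H (f n) g) (ip H f' g)
        \<le> cmod (ip H (f n - f') (g - ?h)) + dist (ip H (f n) ?h) (ip H f' ?h)"
      unfolding dist_norm by (simp add: norm_triangle_ineq)
    also have "cmod (ip H (f n - f') (g - ?h)) \<le> hnorm H (f n - f') * hnorm H (g - ?h)"
      using f(1) f' g h by (intro Cauchy_Schwarz) auto
    also have "\<dots> \<le> M * (e / (2 * M))"
      using diff near M g h f(1) f' by (intro mult_mono) auto
    also have "\<dots> = e / 2" using M by simp
    finally show ?case using elim by simp
  qed
qed

end

section \<open>Shimorin's inequality and multiplier norms on the Bergman space\<close>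

locale bergman_space = analytic_rkhs H bergman_kernel for H
begin

lemma ip_Bergman_kernel:
  assumes "w \<in> \<D>" "v \<in> \<D>"
  shows "ip H (kernel_fun w) (kernel_fun v) = 1 / (1 - v * cnj w)\<^sup>2"
  unfolding ip_kernel_kernel[OF assms] by (simp only: bergman_kernel_def)

text \<open>
  On the span of the kernel functions \<open>k\<^sub>w\<close> with \<open>w \<noteq> 0\<close>, let \<open>T\<close> be the adjoint of multiplication by \<open>z\<close>,
  and let \<open>S\<close> map \<open>k\<^sub>w\<close> to \<open>k\<^sub>w - k\<^sub>0\<close> divided by the conjugate of \<open>w\<close>, so that \<open>\<langle>y, f\<rangle> = \<langle>z y, S f\<rangle>\<close>.  For the
  Bergman kernel, \<open>\<parallel>T f\<parallel>\<^sup>2 + \<parallel>S f\<parallel>\<^sup>2 = 2 \<parallel>f\<parallel>\<^sup>2\<close>, and the claim is the dual inequality.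
\<close>

lemma hnorm_Mz_add_le:
  assumes x: "x \<in> carrier H" "Mz x \<in> carrier H" and y: "y \<in> carrier H" "Mz y \<in> carrier H"
  shows "(hnorm H (Mz x + y))\<^sup>2 \<le> 2 * ((hnorm H x)\<^sup>2 + (hnorm H (Mz y))\<^sup>2)"
proof -
  define B where "B = sqrt (2 * ((hnorm H x)\<^sup>2 + (hnorm H (Mz y))\<^sup>2))"
  have "hnorm H (Mz x + y) \<le> B"
  proof (rule hnorm_le_if_lincomb_kernel)
    fix A c assume A: "finite A" "A \<subseteq> \<D> - {0}"
    define e where "e = (\<lambda>w. cnj w *\<^sub>C kernel_fun w)"
    define d where "d = (\<lambda>w. (1 / cnj w) *\<^sub>C (kernel_fun w - kernel_fun 0))"
    let ?f = "\<Sum>w\<in>A. c w *\<^sub>C kernel_fun w"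
    let ?T = "\<Sum>w\<in>A. c w *\<^sub>C e w" and ?S = "\<Sum>w\<in>A. c w *\<^sub>C d w"
    have AD: "w \<in> \<D>" "w \<noteq> 0" "kernel_fun w \<in> carrier H" if "w \<in> A" for w
      using that A(2) kernel_mem[of w] by auto
    have k0: "kernel_fun 0 \<in> carrier H" using kernel_mem[of 0] by simp
    have ed: "e w \<in> carrier H" "d w \<in> carrier H" if "w \<in> A" for w
      using AD[OF that] k0 by (auto simp: e_def d_def)
    have f: "?f \<in> carrier H" using AD by (auto intro!: sum_mem)
    have T: "?T \<in> carrier H" "?S \<in> carrier H" using ed by (auto intro!: sum_mem)
    have "ip H (e w) (e v) + ip H (d w) (d v) = 2 * ip H (kernel_fun w) (kernel_fun v)"
      if w: "w \<in> A" and v: "v \<in> A" for w v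
    proof -
      have t: "v * cnj w \<noteq> 0" "1 - v * cnj w \<noteq> 0"
        using AD[OF w] AD[OF v] one_minus_mult_cnj_neq_0[of v w] by auto
      have k: "ip H (kernel_fun w) (kernel_fun v) = 1 / (1 - v * cnj w)\<^sup>2"
        "ip H (kernel_fun w) (kernel_fun 0) = 1" "ip H (kernel_fun 0) (kernel_fun v) = 1"
        "ip H (kernel_fun 0) (kernel_fun 0) = 1"
        using ip_Bergman_kernel[of w v] ip_Bergman_kernel[of w 0] ip_Bergman_kernel[of 0 v]
          ip_Bergman_kernel[of 0 0] AD(1)[OF w] AD(1)[OF v] by simp_all
      have "ip H (e w) (e v) = v * cnj w / (1 - v * cnj w)\<^sup>2"
        using AD(3)[OF w] AD(3)[OF v]
        by (simp add: e_def ip_scaleC_left ip_scaleC_right k)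
      moreover have "ip H (d w) (d v) = (1 / (1 - v * cnj w)\<^sup>2 - 1) / (v * cnj w)"
        using AD(3)[OF w] AD(3)[OF v] k0
        by (simp add: d_def ip_scaleC_left ip_scaleC_right ip_diff_left ip_diff_right k)
      \<comment> \<open>Here the specific form of the Bergman kernel enters, with s =
        \<open>v * cnj w\<close>; summed over all pairs, this identity gives
        \<open>TS\<close>.\<close>
      moreover have "s / (1 - s)\<^sup>2 + (1 / (1 - s)\<^sup>2 - 1) / s = 2 * (1 / (1 - s)\<^sup>2)"
        if "s \<noteq> 0" "1 - s \<noteq> 0" for s :: complex
        using that by (simp add: divide_simps) (simp add: power2_eq_square algebra_simps)
      ultimately show ?thesis
        using t by (simp only: k)
    qed
    note pair = this
    have "ip H ?T ?T + ip H ?S ?S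
        = (\<Sum>w\<in>A. \<Sum>v\<in>A. c w * cnj (c v) * (ip H (e w) (e v) + ip H (d w) (d v)))"
      using ed by (simp add: ip_lincomb_self sum.distrib distrib_left)
    also have "\<dots> = (\<Sum>w\<in>A. \<Sum>v\<in>A. 2 * (c w * cnj (c v) * ip H (kernel_fun w) (kernel_fun v)))"
      using pair by (intro sum.cong) auto
    also have "\<dots> = 2 * ip H ?f ?f"
      using AD by (simp add: ip_lincomb_self sum_distrib_left)
    finally have "ip H ?T ?T + ip H ?S ?S = 2 * ip H ?f ?f" .
    then have TS: "(hnorm H ?T)\<^sup>2 + (hnorm H ?S)\<^sup>2 = 2 * (hnorm H ?f)\<^sup>2"
      using f T by (simp add: hnorm_sq complex_eq_iff)
    \<comment> \<open>\<open>Mz y\<close> vanishes at 0, so the subtracted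
      \<open>kernel_fun 0\<close> in \<open>d w\<close> contributes nothing, and the division by
      \<open>cnj w\<close> cancels the factor w of \<open>Mz y\<close>.\<close>
    have eq: "ip H (Mz x + y) ?f = ip H x ?T + ip H (Mz y) ?S"
    proof -
      have "ip H (Mz x + y) (c w *\<^sub>C kernel_fun w) = ip H x (c w *\<^sub>C e w) + ip H (Mz y) (c w *\<^sub>C d w)"
        if "w \<in> A" for w
        using AD[OF that] k0 x y reproducing[of _ 0]
        by (simp add: e_def d_def ip_scaleC_right ip_diff_right ip_add_left reproducing mult_op_def
            field_simps)
      then show ?thesis
        using AD ed x y by (simp add: ip_sum_right sum.distrib cong: sum.cong)
    qed
    have "cmod (ip H (Mz x + y) ?f) \<le> cmod (ip H x ?T) + cmod (ip H (Mz y) ?S)"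
      unfolding eq by (rule norm_triangle_ineq)
    also have "\<dots> \<le> hnorm H x * hnorm H ?T + hnorm H (Mz y) * hnorm H ?S"
      by (rule add_mono[OF Cauchy_Schwarz[OF x(1) T(1)] Cauchy_Schwarz[OF y(2) T(2)]])
    also have "\<dots> \<le> sqrt (((hnorm H x)\<^sup>2 + (hnorm H (Mz y))\<^sup>2) * ((hnorm H ?T)\<^sup>2 + (hnorm H ?S)\<^sup>2))"
    proof (rule real_le_rsqrt)
      have "(a * t + b * s)\<^sup>2 \<le> (a\<^sup>2 + b\<^sup>2) * (t\<^sup>2 + s\<^sup>2)" for a b t s :: real
        using zero_le_power2[of "a * s - b * t"] by (simp add: power2_eq_square algebra_simps)
      then show "(hnorm H x * hnorm H ?T + hnorm H (Mz y) * hnorm H ?S)\<^sup>2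
        \<le> ((hnorm H x)\<^sup>2 + (hnorm H (Mz y))\<^sup>2) * ((hnorm H ?T)\<^sup>2 + (hnorm H ?S)\<^sup>2)" .
    qed
    also have "\<dots> = B * hnorm H ?f"
      unfolding TS B_def real_sqrt_mult using f by (simp add: mult_ac)
    finally show "cmod (ip H (Mz x + y) ?f) \<le> B * hnorm H ?f" .
  qed (use x y in \<open>simp_all add: B_def\<close>)
  then have "(hnorm H (Mz x + y))\<^sup>2 \<le> B\<^sup>2" using x y by (intro power_mono) auto
  then show ?thesis by (simp add: B_def)
qed

text \<open>The adjoint of multiplication by \<open>q\<close> scales \<open>kernel_fun w\<close> by
  \<open>cnj (q w)\<close>. The bound on the kernel form is thus a norm bound for the adjoint on
  kernel combinations, and duality transfers it.\<close>

lemma hnorm_mult_op_le: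
  assumes q: "continuous_on (cball 0 1) q" "q holomorphic_on \<D>"
    and B: "\<And>z. z \<in> cball 0 1 \<Longrightarrow> cmod (q z) \<le> B" "B > 0"
    and x: "x \<in> carrier H" "mult_op q x \<in> carrier H"
  shows "hnorm H (mult_op q x) \<le> B * hnorm H x"
proof (rule hnorm_le_if_lincomb_kernel)
  fix A c assume A: "finite A" "A \<subseteq> \<D> - {0}"
  then have AD: "A \<subseteq> \<D>" by blast
  define f where "f = (\<Sum>w\<in>A. c w *\<^sub>C kernel_fun w)"
  define g where "g = (\<Sum>w\<in>A. (c w * cnj (q w)) *\<^sub>C kernel_fun w)"
  have fg: "f \<in> carrier H" "g \<in> carrier H"
    unfolding f_def g_def by (rule lincomb_kernel_mem[OF AD])+
  have "(hnorm H g)\<^sup>2 \<le> (B * hnorm H f)\<^sup>2"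
    using Bergman_multiplier_bound[OF q B A(1) AD, of c]
    by (simp only: f_def g_def hnorm_lincomb_kernel[OF AD] power_mult_distrib)
  then have "hnorm H g \<le> B * hnorm H f"
    by (rule power2_le_imp_le) (use B(2) fg in simp)
  then have "hnorm H x * hnorm H g \<le> B * hnorm H x * hnorm H f"
    using mult_left_mono[of "hnorm H g" "B * hnorm H f" "hnorm H x"] x by (simp add: mult_ac)
  moreover have "ip H (mult_op q x) f = ip H x g"
    unfolding f_def g_def ip_lincomb_kernel[OF AD x(1)] ip_lincomb_kernel[OF AD x(2)]
    by (simp add: mult_op_def mult.assoc)
  ultimately have "cmod (ip H (mult_op q x) f) \<le> B * hnorm H x * hnorm H f"
    using Cauchy_Schwarz[OF x(1) fg(2)] by simp
  then show "cmod (ip H (mult_op q x) (\<Sum>w\<in>A. c w *\<^sub>C kernel_fun w))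
      \<le> B * hnorm H x * hnorm H (\<Sum>w\<in>A. c w *\<^sub>C kernel_fun w)"
    unfolding f_def .
qed (use B x in auto)

end

section \<open>Approximation of bounded holomorphic functions by polynomials\<close>

lemma bounded_holomorphic_polynomial_approx:
  assumes hol: "\<psi> holomorphic_on \<D>" and M: "\<And>z. z \<in> \<D> \<Longrightarrow> cmod (\<psi> z) \<le> M"
  shows "\<exists>q :: nat \<Rightarrow> complex poly. (\<forall>m. \<forall>z\<in>cball 0 1. cmod (poly (q m) z) \<le> M + 1) \<and>
    (\<forall>z\<in>\<D>. (\<lambda>m. poly (q m) z) \<longlonglongrightarrow> \<psi> z)"
proof -
  define a where "a = (\<lambda>n. (deriv ^^ n) \<psi> 0 / fact n)"
  have series: "(\<lambda>n. a n * z ^ n) sums \<psi> z" if "z \<in> \<D>" for z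
    using holomorphic_power_series[OF hol that] by (simp add: a_def)
  \<comment> \<open>The Taylor series of the dilated function converges uniformly on the closed
    disk, so a partial sum serves as \<open>q\<close>.\<close>
  have approx: "\<exists>q. \<forall>z\<in>cball 0 1. cmod (\<psi> (of_real r * z) - poly q z) < e"
    if r: "0 < r" "r < 1" and e: "e > 0" for r e :: real
  proof -
    \<comment> \<open>Convergence at a radius s > r inside the disk gives absolute convergence at
      r.\<close>
    define s where "s = (1 + r) / 2"
    have s: "r < s" "0 < s" "s < 1" using r by (simp_all add: s_def)
    have "summable (\<lambda>n. a n * of_real s ^ n)"
      using series[of "of_real s"] s by (intro sums_summable) auto
    then have summ: "summable (\<lambda>n. norm (a n * of_real r ^ n))"
      by (rule powser_insidea) (use r s in simp)
    obtain N where N: "norm (\<Sum>i. norm (a (i + N) * of_real r ^ (i + N))) < e"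
      using suminf_exist_split[OF e summ] by blast
    define q where "q = (\<Sum>n<N. monom (a n * of_real r ^ n) n)"
    have "cmod (\<psi> (of_real r * z) - poly q z) < e" if z: "z \<in> cball 0 1" for z
    proof -
      have z1: "cmod z \<le> 1" using z by simp
      have "r * cmod z \<le> r" using r z1 by (intro mult_left_le) auto
      moreover have "cmod (of_real r * z) = r * cmod z" using r by (simp add: norm_mult)
      ultimately have "cmod (of_real r * z) < 1" using r by linarith
      then have "(\<lambda>n. a n * (of_real r * z) ^ n) sums \<psi> (of_real r * z)"
        using series by simp
      from sums_split_initial_segment[OF this, of N]
      have tail: "(\<lambda>i. a (i + N) * (of_real r * z) ^ (i + N)) sums (\<psi> (of_real r * z) - poly q z)"
        by (simp add: q_def poly_sum poly_monom power_mult_distrib mult.assoc)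
      have le: "norm (a n * (of_real r * z) ^ n) \<le> norm (a n * of_real r ^ n)" for n
        using mult_left_mono[OF power_le_one[OF _ z1, of n], of "norm (a n * of_real r ^ n)"]
        by (simp add: norm_mult norm_power power_mult_distrib mult.assoc)
      have summ': "summable (\<lambda>i. norm (a (i + N) * of_real r ^ (i + N)))"
        using summable_ignore_initial_segment[OF summ] .
      then have summ'': "summable (\<lambda>i. norm (a (i + N) * (of_real r * z) ^ (i + N)))"
        by (rule summable_comparison_test'[of _ 0]) (use le in simp)
      have "cmod (\<psi> (of_real r * z) - poly q z) \<le> (\<Sum>i. norm (a (i + N) * (of_real r * z) ^ (i + N)))"
        using summable_norm[OF summ''] sums_unique[OF tail] by simp
      also have "\<dots> \<le> (\<Sum>i. norm (a (i + N) * of_real r ^ (i + N)))"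
        by (rule suminf_le[OF le summ'' summ'])
      also have "\<dots> < e" using N by simp
      finally show ?thesis .
    qed
    then show ?thesis by blast
  qed
  \<comment> \<open>Radii tending to 1; the shift by 2 makes \<open>r 0\<close> positive. The errors
    1 / (m + 1) are at most 1, whence the bound \<open>M + 1\<close>.\<close>
  define r where "r = (\<lambda>m. 1 - 1 / real (m + 2))"
  have r: "0 < r m" "r m < 1" for m by (simp_all add: r_def)
  have "\<exists>q. \<forall>z\<in>cball 0 1. cmod (\<psi> (of_real (r m) * z) - poly q z) < 1 / real (Suc m)" for m
    using approx[OF r] by simp
  then obtain q where q: "\<And>m z. z \<in> cball 0 1 \<Longrightarrow> cmod (\<psi> (of_real (r m) * z) - poly (q m) z) < 1 / real (Suc m)"
    by metis
  have rz: "of_real (r m) * z \<in> \<D>" if "z \<in> cball 0 1" for m and z :: complex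
  proof -
    have "r m * cmod z \<le> r m" using r[of m] that by (intro mult_left_le) auto
    moreover have "cmod (of_real (r m) * z) = r m * cmod z" using r[of m] by (simp add: norm_mult)
    ultimately have "cmod (of_real (r m) * z) < 1" using r[of m] by linarith
    then show ?thesis by simp
  qed
  have "cmod (poly (q m) z) \<le> M + 1" if z: "z \<in> cball 0 1" for m z
  proof -
    have "cmod (poly (q m) z) \<le> cmod (\<psi> (of_real (r m) * z)) + cmod (\<psi> (of_real (r m) * z) - poly (q m) z)"
      using norm_triangle_sub[of "poly (q m) z" "\<psi> (of_real (r m) * z)"] by (simp add: norm_minus_commute)
    also have "\<dots> \<le> M + 1 / real (Suc m)" using M[OF rz[OF z]] q[OF z, of m] by (intro add_mono) auto
    also have "\<dots> \<le> M + 1" by simp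
    finally show ?thesis .
  qed
  moreover have "(\<lambda>m. poly (q m) z) \<longlonglongrightarrow> \<psi> z" if z: "z \<in> \<D>" for z
  proof -
    have "(\<lambda>m. \<psi> (of_real (r m) * z) - poly (q m) z) \<longlonglongrightarrow> 0"
    proof (rule Lim_null_comparison[OF _ LIMSEQ_Suc[OF lim_1_over_n]])
      show "\<forall>\<^sub>F m in sequentially. norm (\<psi> (of_real (r m) * z) - poly (q m) z) \<le> 1 / of_nat (Suc m)"
        using q[of z] z by (intro always_eventually allI less_imp_le) simp
    qed
    moreover have "(\<lambda>m. \<psi> (of_real (r m) * z)) \<longlonglongrightarrow> \<psi> z"
    proof (rule isCont_tendsto_compose[of z \<psi>])
      show "isCont \<psi> z"
        using holomorphic_on_imp_continuous_on[OF hol] z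
        by (simp add: continuous_on_eq_continuous_at)
      have "(\<lambda>m. 1 / real (m + 2)) \<longlonglongrightarrow> 0"
        using LIMSEQ_ignore_initial_segment[OF lim_1_over_n, of 2] .
      then have "r \<longlonglongrightarrow> 1 - 0" unfolding r_def by (intro tendsto_intros)
      then have "(\<lambda>m. of_real (r m) * z) \<longlonglongrightarrow> of_real (1 - 0) * z" by (intro tendsto_intros)
      then show "(\<lambda>m. of_real (r m) * z) \<longlonglongrightarrow> z" by simp
    qed
    ultimately have "(\<lambda>m. \<psi> (of_real (r m) * z) - (\<psi> (of_real (r m) * z) - poly (q m) z)) \<longlonglongrightarrow> \<psi> z - 0"
      by (intro tendsto_diff)
    then show ?thesis by simp
  qed
  ultimately show ?thesis by blast
qed

section \<open>Invariant subspaces of the Bergman space\<close>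

context bergman_space
begin

lemma Lat_Mz:
  assumes "I \<in> Lat H Mz"
  shows "cvec.subspace I" "I \<subseteq> carrier H" "hclosure H I = I" "f \<in> I \<Longrightarrow> Mz f \<in> I"
  using assms by (auto simp: Lat_def)

text \<open>Projecting removes only a part orthogonal to \<open>I\<close>, so the projected kernel
  function is the reproducing kernel of \<open>I\<close>.\<close>

lemma ip_orth_proj_kernel:
  assumes I: "I \<in> Lat H Mz" and w: "w \<in> \<D>" and f: "f \<in> I"
  shows "ip H f (orth_proj H I (kernel_fun w)) = f w"
proof -
  note L = Lat_Mz[OF I]
  let ?k = "orth_proj H I (kernel_fun w)"
  have mem: "?k \<in> carrier H" "f \<in> carrier H" "kernel_fun w \<in> carrier H"
    using orth_proj_mem[OF L(1-3) kernel_mem[OF w]] L(2) f kernel_mem[OF w] by auto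
  have "ip H (kernel_fun w - ?k) f = 0"
    using orth_proj_orth[OF L(1-3) kernel_mem[OF w] f] .
  then have "ip H f (kernel_fun w) = ip H f ?k"
    using mem ip_commute[of f "kernel_fun w"] ip_commute[of f ?k] by (simp add: ip_diff_left)
  then show ?thesis using reproducing[OF mem(2) w] by simp
qed

lemma mult_op_poly_mem:
  assumes I: "I \<in> Lat H Mz" and f: "f \<in> I"
  shows "mult_op (poly q) f \<in> I"
proof (induction q)
  case 0
  have "mult_op (poly 0) f = 0" by (simp add: mult_op_def fun_eq_iff)
  then show ?case using cvec.subspace_0[OF Lat_Mz(1)[OF I]] by (simp only:)
next
  case (pCons a q)
  have eq: "mult_op (poly (pCons a q)) f = a *\<^sub>C f + Mz (mult_op (poly q) f)"
    by (simp add: mult_op_def fun_eq_iff scaleC_fun_def scaleC_complex_def algebra_simps)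
  show ?case
    unfolding eq by (intro cvec.subspace_add cvec.subspace_scale Lat_Mz[OF I] f pCons.IH)
qed

text \<open>Polynomial multiples of \<open>\<phi>\<close> lie in \<open>I\<close>, are bounded in
  norm and converge weakly to \<open>f\<close>. Hence the part of \<open>f\<close> orthogonal to
  \<open>I\<close> is orthogonal to \<open>f\<close>, and so to itself.\<close>

lemma bounded_holomorphic_multiple_mem:
  assumes I: "I \<in> Lat H Mz" and \<phi>: "\<phi> \<in> I" and f: "f \<in> carrier H"
    and \<psi>: "\<psi> holomorphic_on \<D>" "\<And>z. z \<in> \<D> \<Longrightarrow> cmod (\<psi> z) \<le> M"
    and eq: "\<And>z. z \<in> \<D> \<Longrightarrow> f z = \<psi> z * \<phi> z"
  shows "f \<in> I"
proof -
  note L = Lat_Mz[OF I]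
  obtain q :: "nat \<Rightarrow> complex poly" where q: "\<And>m z. z \<in> cball 0 1 \<Longrightarrow> cmod (poly (q m) z) \<le> M + 1"
    and q_lim: "\<And>z. z \<in> \<D> \<Longrightarrow> (\<lambda>m. poly (q m) z) \<longlonglongrightarrow> \<psi> z"
    using bounded_holomorphic_polynomial_approx[OF \<psi>] by blast
  have "0 \<le> M" using order_trans[OF norm_ge_zero \<psi>(2)[of 0]] by simp
  define g where "g = f - orth_proj H I f"
  have p: "orth_proj H I f \<in> I" using orth_proj_mem[OF L(1-3) f] .
  then have g: "g \<in> carrier H" unfolding g_def using f L(2) by auto
  have g_orth: "ip H u g = 0" if "u \<in> I" for u
    using orth_proj_orth[OF L(1-3) f that] ip_commute[of u g] that L(2) g by (auto simp: g_def)
  have mem: "mult_op (poly (q m)) \<phi> \<in> I" for m using mult_op_poly_mem[OF I \<phi>] .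
  have "(\<lambda>m. ip H (mult_op (poly (q m)) \<phi>) g) \<longlonglongrightarrow> ip H f g"
  proof (rule ip_tendsto_if_pointwise[OF _ _ f _ g])
    show "mult_op (poly (q m)) \<phi> \<in> carrier H" for m using mem L(2) by blast
    show "hnorm H (mult_op (poly (q m)) \<phi>) \<le> (M + 1) * hnorm H \<phi>" for m
      using q \<open>0 \<le> M\<close> \<phi> mem[of m] L(2)
      by (intro hnorm_mult_op_le) (auto intro!: continuous_intros holomorphic_intros)
    show "(\<lambda>m. mult_op (poly (q m)) \<phi> w) \<longlonglongrightarrow> f w" if "w \<in> \<D>" for w
      unfolding mult_op_def eq[OF that] by (intro tendsto_intros q_lim that)
  qed
  then have "ip H f g = 0"
    using g_orth[OF mem] by (simp add: LIMSEQ_const_iff)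
  moreover have "ip H (orth_proj H I f) g = 0" using g_orth p by blast
  ultimately have "ip H g g = 0"
    using ip_diff_left[OF f _ g, of "orth_proj H I f"] p L(2) unfolding g_def by auto
  then have "g = 0" using g ip_pos[of g] by (cases "g = 0") auto
  then show ?thesis using p by (simp add: g_def)
qed

section \<open>Closedness of z I and its orthogonal complement in I\<close>

lemma hclosure_Mz_image:
  assumes I: "I \<in> Lat H Mz"
  shows "hclosure H (Mz ` I) \<subseteq> Mz ` I"
proof
  note L = Lat_Mz[OF I]
  have lin: "Mz (f - g) = Mz f - Mz g" "Mz 0 = 0" for f g
    by (simp_all add: mult_op_def fun_eq_iff algebra_simps)
  \<comment> \<open>Shimorin's inequality with \<open>x\<close> = 0 and with \<open>y\<close> = 0.
    The first estimate makes preimages of a convergent sequence Cauchy, the second identifies the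
    limit.\<close>
  have lower: "hnorm H f \<le> 2 * hnorm H (Mz f)" and upper: "hnorm H (Mz f) \<le> 2 * hnorm H f"
    if f: "f \<in> I" for f
  proof -
    have m: "f \<in> carrier H" "Mz f \<in> carrier H" using L f by auto
    have "(hnorm H f)\<^sup>2 \<le> 2 * (hnorm H (Mz f))\<^sup>2"
      using hnorm_Mz_add_le[of 0 f] m lin(2) by simp
    also have "\<dots> \<le> (2 * hnorm H (Mz f))\<^sup>2" by (simp add: power_mult_distrib)
    finally have "(hnorm H f)\<^sup>2 \<le> (2 * hnorm H (Mz f))\<^sup>2" .
    then show "hnorm H f \<le> 2 * hnorm H (Mz f)" by (rule power2_le_imp_le) (use m in simp)
    have "(hnorm H (Mz f))\<^sup>2 \<le> 2 * (hnorm H f)\<^sup>2"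
      using hnorm_Mz_add_le[of f 0] m lin(2) by simp
    also have "\<dots> \<le> (2 * hnorm H f)\<^sup>2" by (simp add: power_mult_distrib)
    finally have "(hnorm H (Mz f))\<^sup>2 \<le> (2 * hnorm H f)\<^sup>2" .
    then show "hnorm H (Mz f) \<le> 2 * hnorm H f" by (rule power2_le_imp_le) (use m in simp)
  qed
  fix g assume "g \<in> hclosure H (Mz ` I)"
  then have g: "g \<in> carrier H" and near: "\<And>e. e > 0 \<Longrightarrow> \<exists>u\<in>I. hnorm H (g - Mz u) < e"
    unfolding hclosure_def by auto
  have "\<exists>u\<in>I. hnorm H (g - Mz u) < 1 / real (Suc n)" for n
    using near[of "1 / real (Suc n)"] by simp
  then obtain s where s: "\<And>n. s n \<in> I" "\<And>n. hnorm H (g - Mz (s n)) < 1 / real (Suc n)"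
    by metis
  have sI: "s m - s n \<in> I" for m n using s(1) L(1) by (simp add: cvec.subspace_diff)
  have sH: "s n \<in> carrier H" "Mz (s n) \<in> carrier H" for n using s(1) L by auto
  have "\<exists>y\<in>carrier H. (\<lambda>n. hnorm H (s n - y)) \<longlonglongrightarrow> 0"
  proof (rule complete[OF sH(1)])
    fix e :: real assume e: "e > 0"
    obtain N where N: "1 / real (Suc N) < e / 4"
      using e by (metis nat_approx_posE zero_less_divide_iff zero_less_numeral)
    have "hnorm H (s m - s n) < e" if "m \<ge> N" "n \<ge> N" for m n
    proof -
      have "1 / real (Suc m) \<le> 1 / real (Suc N)" "1 / real (Suc n) \<le> 1 / real (Suc N)"
        using that by (simp_all add: frac_le)
      then have small: "hnorm H (g - Mz (s m)) < e / 4" "hnorm H (g - Mz (s n)) < e / 4"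
        using s(2)[of m] s(2)[of n] N by linarith+
      have "hnorm H (s m - s n) \<le> 2 * hnorm H (Mz (s m) - Mz (s n))"
        using lower[OF sI[of m n]] by (simp only: lin)
      also have "hnorm H (Mz (s m) - Mz (s n)) \<le> hnorm H (Mz (s m) - g) + hnorm H (g - Mz (s n))"
        by (rule hnorm_triangle_diff[OF sH(2) g sH(2)])
      finally show ?thesis
        using small hnorm_minus_commute[OF g sH(2)[of m]] by simp
    qed
    then show "\<exists>N. \<forall>m\<ge>N. \<forall>n\<ge>N. hnorm H (s m - s n) < e" by blast
  qed
  then obtain y where y: "y \<in> carrier H" and lim: "(\<lambda>n. hnorm H (s n - y)) \<longlonglongrightarrow> 0" by blast
  have "y \<in> hclosure H I"
    unfolding hclosure_def
  proof (intro CollectI conjI allI impI y)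
    fix e :: real assume "e > 0"
    then obtain n where "hnorm H (s n - y) < e"
      using order_tendstoD(2)[OF lim] eventually_happens'[OF sequentially_bot] by blast
    then show "\<exists>u\<in>I. hnorm H (y - u) < e"
      using s(1) hnorm_minus_commute[OF y sH(1)] by metis
  qed
  then have yI: "y \<in> I" using L(3) by simp
  have yH: "Mz y \<in> carrier H" using yI L by auto
  have "hnorm H (g - Mz y) \<le> 0"
  proof (rule LIMSEQ_le_const)
    have "(\<lambda>n. 1 / real (Suc n) + 2 * hnorm H (s n - y)) \<longlonglongrightarrow> 0 + 2 * 0"
      by (intro tendsto_intros lim LIMSEQ_Suc[OF lim_1_over_n])
    then show "(\<lambda>n. 1 / real (Suc n) + 2 * hnorm H (s n - y)) \<longlonglongrightarrow> 0" by simp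
    have "hnorm H (g - Mz y) \<le> 1 / real (Suc n) + 2 * hnorm H (s n - y)" for n
    proof -
      have "s n - y \<in> I" using s(1) yI L(1) by (simp add: cvec.subspace_diff)
      then have "hnorm H (Mz (s n) - Mz y) \<le> 2 * hnorm H (s n - y)"
        using upper[of "s n - y"] by (simp only: lin)
      then show ?thesis
        using hnorm_triangle_diff[OF g sH(2)[of n] yH] s(2)[of n] by simp
    qed
    then show "\<exists>N. \<forall>n\<ge>N. hnorm H (g - Mz y) \<le> 1 / real (Suc n) + 2 * hnorm H (s n - y)" by blast
  qed
  moreover have "g - Mz y \<in> carrier H" using diff_mem[OF g yH] .
  ultimately have "g - Mz y = 0" by (metis antisym hnorm_eq_0_iff hnorm_nonneg)
  then show "g \<in> Mz ` I" using yI by simp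
qed

text \<open>The projection onto the closure of z I has the form \<open>Mz q\<close> because z I is
  closed.\<close>

lemma Mz_decomposition:
  assumes I: "I \<in> Lat H Mz" and f: "f \<in> I"
  shows "\<exists>q\<in>I. \<forall>u\<in>I. ip H (f - Mz q) (Mz u) = 0"
proof -
  note L = Lat_Mz[OF I]
  have "cvec.subspace (Mz ` I)"
  proof (rule cvec.subspaceI)
    have "Mz 0 = 0" by (simp add: mult_op_def fun_eq_iff)
    then show "0 \<in> Mz ` I" using cvec.subspace_0[OF L(1)] by (metis imageI)
  next
    fix x y assume "x \<in> Mz ` I" "y \<in> Mz ` I"
    then obtain a b where "a \<in> I" "b \<in> I" "x = Mz a" "y = Mz b" by blast
    moreover have "Mz (a + b) = Mz a + Mz b" by (simp add: mult_op_def fun_eq_iff algebra_simps)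
    ultimately show "x + y \<in> Mz ` I" using cvec.subspace_add[OF L(1)] by (metis imageI)
  next
    fix c x assume "x \<in> Mz ` I"
    then obtain a where "a \<in> I" "x = Mz a" by blast
    moreover have "Mz (c *\<^sub>C a) = c *\<^sub>C Mz a"
      by (simp add: mult_op_def fun_eq_iff scaleC_fun_def scaleC_complex_def)
    ultimately show "c *\<^sub>C x \<in> Mz ` I" using cvec.subspace_scale[OF L(1)] by (metis imageI)
  qed
  moreover have "Mz ` I \<subseteq> carrier H" using L by auto
  moreover have "f \<in> carrier H" using f L(2) by blast
  ultimately obtain y where "y \<in> hclosure H (Mz ` I)" "\<forall>u\<in>Mz ` I. ip H (f - y) u = 0"
    using projection_closure_exists by blast
  then show ?thesis using hclosure_Mz_image[OF I] by blast
qed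

text \<open>The complement of z I in \<open>I\<close> lies in the kernel of the adjoint of the
  restricted \<open>Mz\<close>, hence in a line; the element \<open>f\<close> with
  \<open>f 0 \<noteq> 0\<close> provides a nonzero vector in it.\<close>

lemma wandering_vector_exists:
  assumes I: "I \<in> Lat H Mz"
    and dim: "cvec.dim (eigenspace (H\<lparr>carrier := I\<rparr>) (adj (H\<lparr>carrier := I\<rparr>) Mz) 0) = 1"
    and f: "f \<in> I" "f 0 \<noteq> 0"
  shows "\<exists>\<phi>\<in>I. hnorm H \<phi> = 1 \<and> (\<forall>u\<in>I. ip H \<phi> (Mz u) = 0) \<and>
    (\<forall>e\<in>I. (\<forall>u\<in>I. ip H e (Mz u) = 0) \<longrightarrow> (\<exists>a. e = a *\<^sub>C \<phi>))"
proof -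
  note L = Lat_Mz[OF I]
  define E where "E = eigenspace (H\<lparr>carrier := I\<rparr>) (adj (H\<lparr>carrier := I\<rparr>) Mz) 0"
  have I0: "0 \<in> I" using cvec.subspace_0[OF L(1)] .
  have in_E: "e \<in> E" if e: "e \<in> I" "\<forall>u\<in>I. ip H e (Mz u) = 0" for e
  proof -
    have "adj (H\<lparr>carrier := I\<rparr>) Mz e = 0"
      unfolding adj_def
    proof (rule the_equality)
      have "ip H (Mz u) e = ip H u 0" if u: "u \<in> I" for u
      proof -
        have m: "u \<in> carrier H" "Mz u \<in> carrier H" "e \<in> carrier H" using L e(1) u by auto
        then show ?thesis using ip_commute[of "Mz u" e] e(2) u by simp
      qed
      then show "0 \<in> carrier (H\<lparr>carrier := I\<rparr>) \<and>
          (\<forall>u\<in>carrier (H\<lparr>carrier := I\<rparr>). ip (H\<lparr>carrier := I\<rparr>) (Mz u) e = ip (H\<lparr>carrier := I\<rparr>) u 0)"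
        using I0 by simp
    next
      fix y assume y: "y \<in> carrier (H\<lparr>carrier := I\<rparr>) \<and>
          (\<forall>u\<in>carrier (H\<lparr>carrier := I\<rparr>). ip (H\<lparr>carrier := I\<rparr>) (Mz u) e = ip (H\<lparr>carrier := I\<rparr>) u y)"
      then have m: "y \<in> carrier H" "Mz y \<in> carrier H" "e \<in> carrier H" using L e(1) by auto
      \<comment> \<open>Uniqueness of the adjoint's value follows by testing its defining identity
        at \<open>y\<close> itself.\<close>
      have "ip H y y = ip H (Mz y) e" using y by simp
      also have "\<dots> = 0" using e(2) y m ip_commute[of "Mz y" e] by simp
      finally show "y = 0" using m(1) ip_pos[of y] by (cases "y = 0") auto
    qed
    then show ?thesis unfolding E_def eigenspace_def using e(1) by simp
  qed
  obtain Bs where Bs: "E \<subseteq> cvec.span Bs" "card Bs = cvec.dim E"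
    using cvec.basis_exists[of E] by metis
  then obtain b where b: "Bs = {b}" using dim unfolding E_def by (auto simp: card_1_singleton_iff)
  have E_b: "\<exists>a. e = a *\<^sub>C b" if "e \<in> E" for e
    using Bs(1) that unfolding b cvec.span_singleton by blast
  obtain q where q: "q \<in> I" "\<forall>u\<in>I. ip H (f - Mz q) (Mz u) = 0"
    using Mz_decomposition[OF I f(1)] by blast
  \<comment> \<open>\<open>Mz q\<close> vanishes at 0, so \<open>e0\<close> keeps the value
    \<open>f 0\<close> and is nonzero.\<close>
  define e0 where "e0 = f - Mz q"
  have e0: "e0 \<in> I" unfolding e0_def using f(1) q(1) L by (simp add: cvec.subspace_diff)
  have e0H: "e0 \<in> carrier H" using e0 L(2) by blast
  have "e0 0 = f 0" by (simp add: e0_def mult_op_def)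
  then have nz: "e0 \<noteq> 0" using f(2) by auto
  obtain c0 where c0: "e0 = c0 *\<^sub>C b" using E_b[OF in_E[OF e0]] q(2) unfolding e0_def by blast
  have c0_nz: "c0 \<noteq> 0" using nz c0 by auto
  define n where "n = hnorm H e0"
  have n: "n > 0" using nz e0H hnorm_nonneg[of e0] hnorm_eq_0_iff[of e0] unfolding n_def by linarith
  define \<phi> where "\<phi> = of_real (1 / n) *\<^sub>C e0"
  show ?thesis
  proof (intro bexI[of _ \<phi>] conjI ballI impI)
    show "\<phi> \<in> I" unfolding \<phi>_def using e0 L(1) by (simp add: cvec.subspace_scale)
    show "hnorm H \<phi> = 1" unfolding \<phi>_def hnorm_scaleC[OF e0H] using n by (simp add: n_def norm_divide)
    show "ip H \<phi> (Mz u) = 0" if "u \<in> I" for u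
    proof -
      have "Mz u \<in> carrier H" using that L by auto
      then show ?thesis unfolding \<phi>_def using q(2) that e0H by (simp add: ip_scaleC_left e0_def)
    qed
    show "\<exists>a. e = a *\<^sub>C \<phi>" if e: "e \<in> I" "\<forall>u\<in>I. ip H e (Mz u) = 0" for e
    proof -
      obtain a where a: "e = a *\<^sub>C b" using E_b[OF in_E[OF e]] by blast
      have "e = (a / c0 * of_real n) *\<^sub>C \<phi>"
        unfolding \<phi>_def c0 a using n c0_nz by (simp add: scaleC_scaleC)
      then show ?thesis by blast
    qed
  qed
qed

text \<open>
  Let \<open>k\<close> be the reproducing kernel of \<open>I\<close> at \<open>w\<close> and write \<open>k = a \<phi> + z q\<close> with \<open>q \<in> I\<close>, so that \<open>a\<close> is
  the conjugate of \<open>\<phi>(w)\<close>.  The bound results from the Cauchy-Schwarz inequality for \<open>\<langle>z x + q, k\<rangle>\<close>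
  combined with the bound on \<open>\<parallel>z x + q\<parallel>\<close>, where the multiple \<open>x\<close> of \<open>k\<close> is chosen to make the two optimal.
\<close>

lemma hnorm_orth_proj_kernel_le:
  assumes I: "I \<in> Lat H Mz" and w: "w \<in> \<D>"
    and \<phi>: "\<phi> \<in> I" "hnorm H \<phi> = 1" "\<And>u. u \<in> I \<Longrightarrow> ip H \<phi> (Mz u) = 0"
    and wandering: "\<And>e. \<lbrakk>e \<in> I; \<And>u. u \<in> I \<Longrightarrow> ip H e (Mz u) = 0\<rbrakk> \<Longrightarrow> \<exists>a. e = a *\<^sub>C \<phi>"
  shows "(hnorm H (orth_proj H I (kernel_fun w)))\<^sup>2 * (1 - (cmod w)\<^sup>2)\<^sup>2 \<le> (cmod (\<phi> w))\<^sup>2"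
proof -
  note L = Lat_Mz[OF I]
  define k where "k = orth_proj H I (kernel_fun w)"
  have k: "k \<in> I" unfolding k_def using orth_proj_mem[OF L(1-3) kernel_mem[OF w]] .
  have eval: "ip H f k = f w" if "f \<in> I" for f
    unfolding k_def using ip_orth_proj_kernel[OF I w that] .
  define N where "N = (hnorm H k)\<^sup>2"
  define r where "r = (cmod w)\<^sup>2"
  obtain q where q: "q \<in> I" "\<And>u. u \<in> I \<Longrightarrow> ip H (k - Mz q) (Mz u) = 0"
    using Mz_decomposition[OF I k] by blast
  have zq: "Mz q \<in> I" "Mz k \<in> I" using q(1) k L by auto
  have H: "k \<in> carrier H" "q \<in> carrier H" "Mz q \<in> carrier H" "Mz k \<in> carrier H" "\<phi> \<in> carrier H"
    using k q(1) zq \<phi>(1) L(2) by auto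
  have "k - Mz q \<in> I" using k zq L(1) by (simp add: cvec.subspace_diff)
  then obtain a where a: "k - Mz q = a *\<^sub>C \<phi>" using wandering q(2) by blast
  have k_eq: "k = a *\<^sub>C \<phi> + Mz q" using a by (simp add: algebra_simps)
  have \<phi>\<phi>: "ip H \<phi> \<phi> = 1" using ip_self[OF H(5)] \<phi>(2) by simp
  have zq_\<phi>: "ip H (Mz q) \<phi> = 0" using \<phi>(3)[OF q(1)] ip_commute[OF H(3,5)] by simp
  have a_eq: "a = cnj (\<phi> w)"
  proof -
    have "ip H k \<phi> = a" using H by (subst k_eq) (simp add: ip_add_left ip_scaleC_left \<phi>\<phi> zq_\<phi>)
    then show ?thesis using eval[OF \<phi>(1)] ip_commute[OF H(1,5)] by simp
  qed
  have N_kw: "of_real N = k w" using eval[OF k] ip_self[OF H(1)] by (simp add: N_def)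
  have k_w: "k w = of_real ((cmod (\<phi> w))\<^sup>2) + w * q w"
  proof -
    have "k w = (a *\<^sub>C \<phi> + Mz q) w" using k_eq by simp
    also have "\<dots> = a * \<phi> w + w * q w" by (simp add: mult_op_def scaleC_fun_def scaleC_complex_def)
    finally show ?thesis using complex_norm_square[of "\<phi> w"] by (simp add: a_eq mult.commute)
  qed
  have N_eq: "N = (cmod (\<phi> w))\<^sup>2 + (hnorm H (Mz q))\<^sup>2"
  proof -
    have "N = (hnorm H (a *\<^sub>C \<phi> + Mz q))\<^sup>2" using k_eq by (simp add: N_def)
    also have "\<dots> = (cmod a)\<^sup>2 + (hnorm H (Mz q))\<^sup>2"
      using H \<phi>(3)[OF q(1)] by (simp add: hnorm_add_sq hnorm_scaleC ip_scaleC_left \<phi>(2))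
    finally show ?thesis by (simp add: a_eq)
  qed
  \<comment> \<open>\<open>Q\<close> plays two roles for the test vector \<open>g\<close> below:
    \<open>2 * Q\<close> bounds its squared norm, and \<open>w * g w\<close> equals
    \<open>Q\<close>.\<close>
  define Q where "Q = r\<^sup>2 * N + (hnorm H (Mz q))\<^sup>2"
  have Q0: "0 \<le> Q" by (simp add: Q_def N_def)
  have r0: "0 \<le> r" and N0: "0 \<le> N" by (simp_all add: r_def N_def)
  \<comment> \<open>The factor \<open>(cnj w)\<^sup>2\<close> makes the contribution of
    \<open>x\<close> to \<open>w * g w\<close> equal to r^2 \<open>k w\<close> = r^2 N, the squared
    norm of \<open>x\<close>.\<close>
  define x where "x = (cnj w)\<^sup>2 *\<^sub>C k"
  have Mz_x: "Mz x = (cnj w)\<^sup>2 *\<^sub>C Mz k"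
    by (simp add: x_def mult_op_def fun_eq_iff scaleC_fun_def scaleC_complex_def mult_ac)
  define g where "g = Mz x + q"
  have g: "g \<in> I" unfolding g_def Mz_x using zq q(1) L(1) by (simp add: cvec.subspace_add cvec.subspace_scale)
  have gH: "g \<in> carrier H" using g L(2) by blast
  have g_norm: "(hnorm H g)\<^sup>2 \<le> 2 * Q"
  proof -
    have "(hnorm H g)\<^sup>2 \<le> 2 * ((hnorm H x)\<^sup>2 + (hnorm H (Mz q))\<^sup>2)"
      unfolding g_def using H by (intro hnorm_Mz_add_le) (auto simp: Mz_x, auto simp: x_def)
    also have "(hnorm H x)\<^sup>2 = r\<^sup>2 * N"
      unfolding x_def hnorm_scaleC[OF H(1)] by (simp add: norm_power power_mult_distrib r_def N_def)
    finally show ?thesis by (simp add: Q_def)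
  qed
  have "w * g w = of_real Q"
  proof -
    have "g w = (cnj w)\<^sup>2 * (w * k w) + q w"
      by (simp add: g_def Mz_x) (simp add: mult_op_def scaleC_fun_def scaleC_complex_def)
    then have "w * g w = (w * cnj w)\<^sup>2 * k w + w * q w"
      by (simp add: power2_eq_square algebra_simps)
    also have "w * cnj w = of_real r" using complex_norm_square[of w] by (simp add: r_def)
    \<comment> \<open>N is both the value \<open>k w\<close> and the squared norm of
      \<open>k\<close>; comparing \<open>k_w\<close> with \<open>N_eq\<close> leaves this
      equality.\<close>
    also have "w * q w = of_real ((hnorm H (Mz q))\<^sup>2)"
      using k_w N_kw N_eq by (metis add_left_cancel of_real_add)
    finally show ?thesis by (simp add: Q_def flip: N_kw)
  qed
  then have "Q = cmod w * cmod (g w)" using Q0 by (metis abs_of_nonneg norm_mult norm_of_real)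
  then have "Q\<^sup>2 = r * (cmod (g w))\<^sup>2" by (simp add: power_mult_distrib r_def)
  also have "(cmod (g w))\<^sup>2 \<le> (hnorm H g * hnorm H k)\<^sup>2"
    using Cauchy_Schwarz[OF gH H(1)] eval[OF g] by (intro power_mono) auto
  also have "\<dots> = (hnorm H g)\<^sup>2 * N" by (simp add: power_mult_distrib N_def)
  also have "\<dots> \<le> 2 * Q * N" using g_norm N0 by (intro mult_right_mono)
  finally have "Q\<^sup>2 \<le> r * (2 * Q * N)" using r0 by (simp add: mult_left_mono)
  then have "Q * Q \<le> Q * (2 * r * N)" by (simp add: power2_eq_square mult_ac)
  then have "Q \<le> 2 * r * N" using Q0 r0 N0 by (cases "Q = 0") auto
  \<comment> \<open>By \<open>N_eq\<close>, \<open>Q\<close> is r^2 N + N -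
    |\<open>\<phi> w\<close>|^2, so \<open>Q \<le> 2 * r * N\<close> completes the square (1 -
    r)^2.\<close>
  then have "N * (1 - r)\<^sup>2 \<le> (cmod (\<phi> w))\<^sup>2"
    using N_eq by (simp add: Q_def power2_eq_square algebra_simps)
  then show ?thesis by (simp add: N_def r_def k_def)
qed

text \<open>The lower bound on the kernel of \<open>I\<close> meets the upper bound by
  |\<open>\<phi>\<close>|, which leaves |\<open>\<phi>\<close>| at least \<open>sqrt c\<close>.
  Division by \<open>\<phi>\<close> is then bounded, so \<open>I\<close> contains every kernel
  function, and only 0 is orthogonal to all of these.\<close>

lemma Lat_eq_carrier_if_kernel_comparable:
  assumes I: "I \<in> Lat H Mz"
    and dim: "cvec.dim (eigenspace (H\<lparr>carrier := I\<rparr>) (adj (H\<lparr>carrier := I\<rparr>) Mz) 0) = 1"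
    and c: "c > 0"
    and lower: "\<And>w. w \<in> \<D> \<Longrightarrow> c \<le> (hnorm H (orth_proj H I (kernel_fun w)))\<^sup>2 * (1 - (cmod w)\<^sup>2)\<^sup>2"
  shows "I = carrier H"
proof -
  note L = Lat_Mz[OF I]
  let ?k = "\<lambda>w. orth_proj H I (kernel_fun w)"
  have k: "?k w \<in> I" if "w \<in> \<D>" for w using orth_proj_mem[OF L(1-3) kernel_mem[OF that]] .
  \<comment> \<open>This value is the squared norm of \<open>?k 0\<close>, at least \<open>c\<close>
    by the lower bound at 0; thus \<open>?k 0\<close> is an element of \<open>I\<close> not
    vanishing at 0.\<close>
  have "?k 0 0 \<noteq> 0"
  proof
    assume "?k 0 0 = 0"
    then have "ip H (?k 0) (?k 0) = 0" using ip_orth_proj_kernel[OF I _ k[of 0], of 0] by simp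
    moreover have "?k 0 \<in> carrier H" using k[of 0] L(2) by auto
    ultimately have "hnorm H (?k 0) = 0" using ip_self[of "?k 0"] by simp
    then show False using lower[of 0] c by simp
  qed
  then obtain \<phi> where \<phi>: "\<phi> \<in> I" "hnorm H \<phi> = 1" "\<And>u. u \<in> I \<Longrightarrow> ip H \<phi> (Mz u) = 0"
    and wandering: "\<And>e. \<lbrakk>e \<in> I; \<And>u. u \<in> I \<Longrightarrow> ip H e (Mz u) = 0\<rbrakk> \<Longrightarrow> \<exists>a. e = a *\<^sub>C \<phi>"
    using wandering_vector_exists[OF I dim k[of 0]] by (metis centre_in_ball zero_less_one)
  have \<phi>H: "\<phi> \<in> carrier H" using \<phi>(1) L(2) by blast
  have \<phi>_lower: "sqrt c \<le> cmod (\<phi> w)" if "w \<in> \<D>" for w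
  proof (rule real_le_lsqrt)
    have "(hnorm H (?k w))\<^sup>2 * (1 - (cmod w)\<^sup>2)\<^sup>2 \<le> (cmod (\<phi> w))\<^sup>2"
    proof (rule hnorm_orth_proj_kernel_le[OF I that \<phi>(1,2)])
      show "ip H \<phi> (Mz u) = 0" if "u \<in> I" for u using \<phi>(3)[OF that] .
      show "\<exists>a. e = a *\<^sub>C \<phi>" if "e \<in> I" "\<And>u. u \<in> I \<Longrightarrow> ip H e (Mz u) = 0" for e
        using wandering that by blast
    qed
    then show "c \<le> (cmod (\<phi> w))\<^sup>2" using lower[OF that] by linarith
  qed (use c in auto)
  have \<phi>_nz: "\<phi> w \<noteq> 0" if "w \<in> \<D>" for w using \<phi>_lower[OF that] c by auto
  have kernel_in: "kernel_fun v \<in> I" if v: "v \<in> \<D>" for v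
  proof (rule bounded_holomorphic_multiple_mem[OF I \<phi>(1) kernel_mem[OF v]])
    show "(\<lambda>z. bergman_kernel z v / \<phi> z) holomorphic_on \<D>"
      using kernel_holomorphic[OF v] holomorphic[OF \<phi>H] \<phi>_nz by (intro holomorphic_on_divide) auto
    show "kernel_fun v z = bergman_kernel z v / \<phi> z * \<phi> z" if "z \<in> \<D>" for z
      using \<phi>_nz[OF that] that by (simp add: on_disk_def)
    show "cmod (bergman_kernel z v / \<phi> z) \<le> 1 / (1 - cmod v)\<^sup>2 / sqrt c" if z: "z \<in> \<D>" for z
    proof -
      have "cmod z * cmod v \<le> 1 * cmod v" using z by (intro mult_right_mono) auto
      then have "1 - cmod v \<le> cmod (1 - z * cnj v)"
        using norm_triangle_ineq2[of 1 "z * cnj v"] by (simp add: norm_mult)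
      then have "(1 - cmod v)\<^sup>2 \<le> (cmod (1 - z * cnj v))\<^sup>2" using v by (intro power_mono) auto
      then have "cmod (bergman_kernel z v) \<le> 1 / (1 - cmod v)\<^sup>2"
        using v by (simp add: bergman_kernel_def norm_divide norm_power frac_le)
      then show ?thesis
        unfolding norm_divide using \<phi>_lower[OF z] c by (intro frac_le) auto
    qed
  qed
  have "f \<in> I" if f: "f \<in> carrier H" for f
  proof -
    have p: "orth_proj H I f \<in> I" using orth_proj_mem[OF L(1-3) f] .
    have "f - orth_proj H I f = 0"
    proof (rule eq_zero_if_vanishes_off_0)
      show m: "f - orth_proj H I f \<in> carrier H" using f p L(2) by auto
      show "(f - orth_proj H I f) w = 0" if "w \<in> \<D> - {0}" for w
        using orth_proj_orth[OF L(1-3) f kernel_in[of w]] reproducing[OF m, of w] that by auto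
    qed
    then show ?thesis using p by simp
  qed
  then show ?thesis using L(2) by blast
qed

end

section \<open>Equality of the two subspaces and similarity by the identity\<close>

lemma similar_ops_refl:
  assumes "A \<in> carrier H \<rightarrow> carrier H"
  shows "similar_ops H A H A"
  unfolding similar_ops_def bounded_op_def
  by (intro exI[of _ "\<lambda>x. x"]) (auto intro: exI[of _ 1])

theorem corollary3p13:
  fixes HK A2 :: "(complex \<Rightarrow> complex) hilbert"
    and K :: "complex \<Rightarrow> complex \<Rightarrow> complex"
    and p :: "nat \<Rightarrow> complex poly poly"
    and I1 I2 :: "(complex \<Rightarrow> complex) set"
    and C :: real
  assumes atom: "cowen_douglas_atom HK K p"
    and bergman: "analytic_rkhs A2 bergman_kernel"
    and C_pos: "C > 0"
    and kernel_lower: "\<forall>\<omega>\<in>\<D>. (1 - (cmod \<omega>)\<^sup>2)\<^sup>2 * Re (K (cnj \<omega>) (cnj \<omega>)) \<ge> C"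
    and lat: "\<And>I. I \<in> {I1, I2} \<Longrightarrow> I \<in> Lat A2 Mz"
    and cd: "\<And>I. I \<in> {I1, I2} \<Longrightarrow> B1 (A2\<lparr>carrier := I\<rparr>) \<D> (adj (A2\<lparr>carrier := I\<rparr>) Mz)"
    and contractive: "\<And>I. I \<in> {I1, I2} \<Longrightarrow>
      atom_contractive p (A2\<lparr>carrier := I\<rparr>) (adj (A2\<lparr>carrier := I\<rparr>) Mz)"
    and h_lower: "\<And>I. I \<in> {I1, I2} \<Longrightarrow>
      (INF \<omega>\<in>\<D>. bergman_h A2 I \<omega> / Re (K (cnj \<omega>) (cnj \<omega>))) > 0"
  shows "similar_ops (A2\<lparr>carrier := I1\<rparr>) Mz (A2\<lparr>carrier := I2\<rparr>) Mz"
proof -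
  interpret bergman_space A2 using bergman by (simp add: bergman_space_def)
  have K_pos: "Re (K (cnj \<omega>) (cnj \<omega>)) > 0" if "\<omega> \<in> \<D>" for \<omega>
    using kernel_lower that C_pos zero_less_mult_pos[of "(1 - (cmod \<omega>)\<^sup>2)\<^sup>2"]
    by (smt (verit) mult_nonneg_nonpos zero_le_power2)
  have eq: "I = carrier A2" if I: "I \<in> {I1, I2}" for I
  proof -
    define d where "d = (INF \<omega>\<in>\<D>. bergman_h A2 I \<omega> / Re (K (cnj \<omega>) (cnj \<omega>)))"
    have d: "d > 0" unfolding d_def using h_lower[OF I] .
    have h: "d * Re (K (cnj \<omega>) (cnj \<omega>)) \<le> bergman_h A2 I \<omega>" if w: "\<omega> \<in> \<D>" for \<omega>
    proof -
      \<comment> \<open>A real infimum is a lower bound only for a set bounded below; here 0 bounds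
        the quotients since \<open>K\<close> is positive on the diagonal.\<close>
      have "bdd_below ((\<lambda>\<omega>. bergman_h A2 I \<omega> / Re (K (cnj \<omega>) (cnj \<omega>))) ` \<D>)"
        using K_pos by (intro bdd_belowI2[of _ 0]) (auto simp: bergman_h_def less_imp_le)
      then have "d \<le> bergman_h A2 I \<omega> / Re (K (cnj \<omega>) (cnj \<omega>))"
        unfolding d_def using w by (rule cINF_lower)
      then show ?thesis using K_pos[OF w] by (simp add: pos_le_divide_eq)
    qed
    show ?thesis
    proof (rule Lat_eq_carrier_if_kernel_comparable[OF lat[OF I]])
      show "cvec.dim (eigenspace (A2\<lparr>carrier := I\<rparr>) (adj (A2\<lparr>carrier := I\<rparr>) Mz) 0) = 1"
        using cd[OF I] by (simp add: B1_def)
      show "d * C > 0" using d C_pos by simp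
      fix w :: complex assume w: "w \<in> \<D>"
      \<comment> \<open>The hypotheses evaluate kernels at the conjugate point, so they are applied
        at \<open>cnj w\<close>.\<close>
      then have cw: "cnj w \<in> \<D>" by simp
      have "d * C \<le> d * ((1 - (cmod w)\<^sup>2)\<^sup>2 * Re (K w w))"
        using bspec[OF kernel_lower cw] d by (intro mult_left_mono) auto
      also have "\<dots> = (d * Re (K w w)) * (1 - (cmod w)\<^sup>2)\<^sup>2" by simp
      also have "\<dots> \<le> bergman_h A2 I (cnj w) * (1 - (cmod w)\<^sup>2)\<^sup>2"
        using h[OF cw] by (intro mult_right_mono) auto
      finally show "d * C \<le> (hnorm A2 (orth_proj A2 I (kernel_fun w)))\<^sup>2 * (1 - (cmod w)\<^sup>2)\<^sup>2"
        by (simp add: bergman_h_def)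
    qed
  qed
  have "I1 = I2" using eq[of I1] eq[of I2] by simp
  moreover have "Mz \<in> I2 \<rightarrow> I2" using lat[of I2] by (auto simp: Lat_def)
  ultimately show ?thesis by (simp add: similar_ops_refl)
qed

end
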